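(* Among all bicyclic graphs on $n$ vertices, the graph with the second largest value of $\rho(A_f(G))$ is $G_2$, the graph obtained from two triangles sharing exactly one vertex $c$ by attaching $n-5$ pendant vertices to $c$, provided one of the following holds: (i) $f(x,y)=x+y$ and $n\geq 10$; (ii) $f(x,y)=(x+y)^2$ and $n\geq 9$; (iii) $f(x,y)=x^2+y^2$ and $n\geq 8$.
   Context: All graphs are finite, simple and connected. A bicyclic graph on $n$ vertices is a connected simple graph with $n$ vertices and $n+1$ edges. For a graph $G$ with vertex degrees $d_i$, the weighted adjacency matrix $A_f(G)=[a_{ij}]$ has $a_{ij}=f(d_i,d_j)$ if $ij$ is an edge and $a_{ij}=0$ otherwise; $\rho(A_f(G))$ is its spectral radius. *)

theory Defs
  imports
    "Graph_Theory.Pair_Digraph"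
    "Graph_Theory.Digraph_Isomorphism"
    "Jordan_Normal_Form.Spectral_Radius"
begin

text \<open>A finite simple graph is a \<open>pair_graph\<close>: a finite loop-free symmetric digraph without
  parallel arcs. An undirected edge is a pair of opposite arcs, so it is counted through its set
  of endpoints, and the degree of a vertex is its out-degree.\<close>

definition uedges :: "'a pair_pre_digraph \<Rightarrow> 'a set set" where
  "uedges G = {{u, v} | u v. (u, v) \<in> parcs G}"

definition bicyclic :: "'a pair_pre_digraph \<Rightarrow> bool" where
  "bicyclic G \<longleftrightarrow> pair_graph G \<and> Digraph_Component.connected (with_proj G) \<and>
     card (uedges G) = card (pverts G) + 1"

definition bicyclic_graphs :: "nat \<Rightarrow> nat pair_pre_digraph set" where
  "bicyclic_graphs n = {G. pverts G = {..<n} \<and> bicyclic G}"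

abbreviation degree_of :: "'a pair_pre_digraph \<Rightarrow> 'a \<Rightarrow> nat" where
  "degree_of G v \<equiv> out_degree (with_proj G) v"

text \<open>The matrix is indexed by the vertices themselves, so it is only meaningful for graphs whose
  vertex set is an initial segment of the natural numbers, as in \<^const>\<open>bicyclic_graphs\<close>.\<close>

definition weighted_adjacency :: "(real \<Rightarrow> real \<Rightarrow> real) \<Rightarrow> nat pair_pre_digraph \<Rightarrow> real mat" where
  "weighted_adjacency f G = mat (card (pverts G)) (card (pverts G))
     (\<lambda>(i, j). if (i, j) \<in> parcs G then f (real (degree_of G i)) (real (degree_of G j)) else 0)"

definition rho :: "(real \<Rightarrow> real \<Rightarrow> real) \<Rightarrow> nat pair_pre_digraph \<Rightarrow> real" where
  "rho f G = spectral_radius (map_mat complex_of_real (weighted_adjacency f G))"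

text \<open>Exactly one value attained on \<open>S\<close> exceeds the value at \<open>x\<close>.\<close>

definition attains_second_largest :: "('a \<Rightarrow> real) \<Rightarrow> 'a set \<Rightarrow> 'a \<Rightarrow> bool" where
  "attains_second_largest r S x \<longleftrightarrow> x \<in> S \<and> (\<exists>!m. m \<in> r ` S \<and> r x < m)"

text \<open>The shared vertex \<open>c\<close> is \<open>0\<close>, the triangles are \<open>{0, 1, 2}\<close> and \<open>{0, 3, 4}\<close>, and the
  pendant vertices are \<open>5, \<dots>, n - 1\<close>; this is meant for \<open>n \<ge> 5\<close>.\<close>

definition G2 :: "nat \<Rightarrow> nat pair_pre_digraph" where
  "G2 n = \<lparr> pverts = {..<n},
     parcs = (let E = {(0, 1), (0, 2), (1, 2)} \<union> {(0, 3), (0, 4), (3, 4)} \<union> {(0, k) | k. 5 \<le> k \<and> k < n}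
              in E \<union> E\<inverse>) \<rparr>"

end

theory Submission
  imports Defs
begin

text \<open>A vertex adjacent to all others leaves only two further edges, so a bicyclic graph with a
  vertex of degree \<open>n - 1\<close> is a star with two chords: either the chords are disjoint (\<open>G\<^sub>2\<close>) or they
  share a vertex. In both cases a positive eigenvector can be written down, and the spectral radius
  is the fixed point of an explicit decreasing function; comparing the two functions shows that the
  graph with adjacent chords has the larger spectral radius.

  All other graphs have maximum degree at most \<open>n - 2\<close>. For them the Collatz--Wielandt bound is
  applied to the vector \<open>x\<^sub>v = 1 + b (d\<^sub>v - 1)\<close> with \<open>b = (T - 1) / (T\<^sup>2 - 2)\<close> and \<open>T\<^sup>2 = n - 1\<close>, so that a
  vertex of degree \<open>n - 2\<close> has weight \<open>T\<close>. Edge counting controls the first two moments of the numbers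
  \<open>y\<^sub>u = d\<^sub>u - 1\<close> over the neighbours \<open>u\<close> of a vertex, which yields \<open>\<rho> \<le> \<mu>\<close> for an explicit \<open>\<mu>\<close> that is
  still below the fixed point belonging to \<open>G\<^sub>2\<close>.\<close>

section \<open>Spectral radius of nonnegative matrices\<close>

text \<open>A single number \<open>\<mu>\<close> separates the two kinds of graphs: maximum degree
  at most \<open>n - 2\<close> forces a radius of at most \<open>\<mu>\<close>, and both stars with
  chords lie above it. So the many graphs of the first kind need not be classified. The plain star
  on n vertices has radius \<open>T * f (n - 1) 1\<close> and a Perron vector whose centre outweighs
  a leaf by the factor T. The test vector imitates this ratio, and \<open>\<mu>\<close> is the
  radius of the star plus a small correction, which is zero for x^2 + y^2. Taking the weights affine
  in the degree makes a row sum a sum of polynomials of degree at most three in the neighbours'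
  degrees. What has to be known about a neighbourhood then reduces to three numbers: the largest
  \<open>y\<close>, the sum of \<open>y\<close> and the sum of \<open>y * (y - 1)\<close>. The
  thresholds on n enter through T, whose least values are 3, sqrt 8 and sqrt 7; the last two are
  rounded down to 11/4 and 5/2.\<close>

lemma spectral_radius_le_weighted_row_sum:
  fixes A :: "real mat" and x :: "nat \<Rightarrow> real"
  assumes A: "A \<in> carrier_mat n n" and n: "n > 0"
    and nonneg: "\<And>i j. i < n \<Longrightarrow> j < n \<Longrightarrow> A $$ (i, j) \<ge> 0"
    and pos: "\<And>i. i < n \<Longrightarrow> x i > 0"
    and row: "\<And>i. i < n \<Longrightarrow> (\<Sum>j<n. A $$ (i, j) * x j) \<le> \<mu> * x i"
  shows "spectral_radius (map_mat complex_of_real A) \<le> \<mu>"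
proof -
  let ?A = "map_mat complex_of_real A"
  have cA: "?A \<in> carrier_mat n n" using A by simp
  from spectral_radius_mem_max(1)[OF cA n] obtain k
    where k: "eigenvalue ?A k" and sr: "spectral_radius ?A = norm k"
    unfolding spectrum_def by auto
  from k obtain v where v: "v \<in> carrier_vec n" "v \<noteq> 0\<^sub>v n" and Av: "?A *\<^sub>v v = k \<cdot>\<^sub>v v"
    unfolding eigenvalue_def eigenvector_def using A by auto
  \<comment> \<open>One row suffices, that of an index \<open>i\<close> where \<open>g\<close> is
    maximal: there every \<open>norm (v $ j)\<close> is at most \<open>g i * x j\<close>, so the
    hypothesis \<open>row\<close> caps \<open>norm k\<close>.\<close>
  define g where "g i = norm (v $ i) / x i" for i
  obtain i where i: "i < n" and imax: "\<And>j. j < n \<Longrightarrow> g j \<le> g i"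
  proof -
    have "finite (g ` {..<n})" "g ` {..<n} \<noteq> {}" using n by auto
    then have "Max (g ` {..<n}) \<in> g ` {..<n}" by (rule Max_in)
    then obtain i where "i < n" "Max (g ` {..<n}) = g i" by auto
    moreover have "g j \<le> Max (g ` {..<n})" if "j < n" for j using that by (intro Max_ge) auto
    ultimately show ?thesis using that by metis
  qed
  have gi: "g i > 0"
  proof -
    from v obtain j where j: "j < n" "v $ j \<noteq> 0" by (auto simp: vec_eq_iff)
    then have "g j > 0" unfolding g_def using pos by simp
    with imax[OF j(1)] show ?thesis by simp
  qed
  have bound: "norm (v $ j) \<le> g i * x j" if "j < n" for j
    using imax[OF that] pos[OF that] unfolding g_def by (simp add: field_simps)
  have "k * v $ i = (\<Sum>j<n. complex_of_real (A $$ (i, j)) * v $ j)"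
  proof -
    have "k * v $ i = (?A *\<^sub>v v) $ i" unfolding Av using i v by simp
    also have "\<dots> = (\<Sum>j<n. complex_of_real (A $$ (i, j)) * v $ j)"
      using i v A by (auto simp: scalar_prod_def atLeast0LessThan intro!: sum.cong)
    finally show ?thesis .
  qed
  then have "norm k * norm (v $ i) = norm (\<Sum>j<n. complex_of_real (A $$ (i, j)) * v $ j)"
    by (metis norm_mult)
  also have "\<dots> \<le> (\<Sum>j<n. norm (complex_of_real (A $$ (i, j)) * v $ j))" by (rule norm_sum)
  also have "\<dots> \<le> (\<Sum>j<n. A $$ (i, j) * (g i * x j))"
    using nonneg i bound by (intro sum_mono) (auto simp: norm_mult intro!: mult_left_mono)
  also have "\<dots> = g i * (\<Sum>j<n. A $$ (i, j) * x j)"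
    by (simp add: sum_distrib_left algebra_simps)
  also have "\<dots> \<le> g i * (\<mu> * x i)" using row[OF i] gi by simp
  also have "\<dots> = \<mu> * norm (v $ i)" using pos[OF i] unfolding g_def by simp
  finally have "norm k * norm (v $ i) \<le> \<mu> * norm (v $ i)" .
  moreover have "norm (v $ i) > 0" using gi pos[OF i] unfolding g_def by (simp add: zero_less_divide_iff)
  ultimately show ?thesis unfolding sr by simp
qed

text \<open>The upper bound is the previous lemma; conversely \<open>\<mu>\<close> is itself an
  eigenvalue, so its modulus is at most the spectral radius.\<close>

lemma spectral_radius_eq_positive_eigenvector:
  fixes A :: "real mat" and x :: "nat \<Rightarrow> real"
  assumes A: "A \<in> carrier_mat n n" and n: "n > 0"
    and nonneg: "\<And>i j. i < n \<Longrightarrow> j < n \<Longrightarrow> A $$ (i, j) \<ge> 0"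
    and pos: "\<And>i. i < n \<Longrightarrow> x i > 0"
    and row: "\<And>i. i < n \<Longrightarrow> (\<Sum>j<n. A $$ (i, j) * x j) = \<mu> * x i"
  shows "spectral_radius (map_mat complex_of_real A) = \<mu>"
proof (rule antisym)
  show "spectral_radius (map_mat complex_of_real A) \<le> \<mu>"
    using assms by (intro spectral_radius_le_weighted_row_sum[where n = n and x = x]) auto
  let ?A = "map_mat complex_of_real A"
  have cA: "?A \<in> carrier_mat n n" using A by simp
  define v where "v = vec n (\<lambda>i. complex_of_real (x i))"
  have "v $ 0 \<noteq> 0" using n pos[of 0] by (simp add: v_def)
  then have "v \<noteq> 0\<^sub>v n" using n by auto
  moreover have "?A *\<^sub>v v = complex_of_real \<mu> \<cdot>\<^sub>v v"
  proof (rule eq_vecI)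
    fix i assume "i < dim_vec (complex_of_real \<mu> \<cdot>\<^sub>v v)"
    then have i: "i < n" by (simp add: v_def)
    have "(?A *\<^sub>v v) $ i = (\<Sum>j<n. complex_of_real (A $$ (i, j)) * complex_of_real (x j))"
      using i A by (auto simp: scalar_prod_def atLeast0LessThan v_def intro!: sum.cong)
    also have "\<dots> = complex_of_real (\<Sum>j<n. A $$ (i, j) * x j)" by simp
    also have "\<dots> = (complex_of_real \<mu> \<cdot>\<^sub>v v) $ i" using i row[OF i] by (simp add: v_def)
    finally show "(?A *\<^sub>v v) $ i = (complex_of_real \<mu> \<cdot>\<^sub>v v) $ i" .
  qed (use A in \<open>simp add: v_def\<close>)
  ultimately have "eigenvalue ?A (complex_of_real \<mu>)"
    unfolding eigenvalue_def eigenvector_def using A by (intro exI[of _ v]) (auto simp: v_def)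
  then have "norm (complex_of_real \<mu>) \<in> norm ` spectrum ?A" unfolding spectrum_def by blast
  from spectral_radius_mem_max(2)[OF cA n this] show "\<mu> \<le> spectral_radius ?A" by simp
qed

section \<open>Row sums over neighbourhoods\<close>

definition nbrs :: "'a pair_pre_digraph \<Rightarrow> 'a \<Rightarrow> 'a set" where
  "nbrs G v = {w. (v, w) \<in> parcs G}"

lemma degree_of_eq_card_nbrs: "degree_of G v = card (nbrs G v)"
proof -
  have "out_arcs (with_proj G) v = Pair v ` nbrs G v"
    by (auto simp: out_arcs_def nbrs_def)
  then show ?thesis by (simp add: out_degree_def card_image inj_on_def)
qed

lemma weighted_adjacency_row_sum:
  assumes V: "pverts G = {..<n}" and i: "i < n" and N: "nbrs G i \<subseteq> {..<n}"
  shows "(\<Sum>j<n. weighted_adjacency f G $$ (i, j) * x j)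
    = (\<Sum>j\<in>nbrs G i. f (real (degree_of G i)) (real (degree_of G j)) * x j)"
proof -
  have "(\<Sum>j<n. weighted_adjacency f G $$ (i, j) * x j)
    = (\<Sum>j<n. if j \<in> nbrs G i then f (real (degree_of G i)) (real (degree_of G j)) * x j else 0)"
    using i by (intro sum.cong) (auto simp: weighted_adjacency_def V nbrs_def)
  also have "\<dots> = (\<Sum>j\<in>{..<n} \<inter> nbrs G i. f (real (degree_of G i)) (real (degree_of G j)) * x j)"
    by (simp add: sum.inter_restrict)
  finally show ?thesis using N by (simp add: Int_absorb1)
qed

lemma rho_eq_positive_eigenvector:
  fixes x :: "nat \<Rightarrow> real"
  assumes V: "pverts G = {..<n}" and n: "n > 0" and N: "\<And>i. i < n \<Longrightarrow> nbrs G i \<subseteq> {..<n}"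
    and f: "\<And>a b. 0 \<le> a \<Longrightarrow> 0 \<le> b \<Longrightarrow> 0 \<le> f a b" and pos: "\<And>i. i < n \<Longrightarrow> x i > 0"
    and row: "\<And>i. i < n \<Longrightarrow>
      (\<Sum>j\<in>nbrs G i. f (real (degree_of G i)) (real (degree_of G j)) * x j) = \<mu> * x i"
  shows "rho f G = \<mu>"
  unfolding rho_def
proof (rule spectral_radius_eq_positive_eigenvector[where n = n and x = x])
  show "weighted_adjacency f G \<in> carrier_mat n n" by (simp add: weighted_adjacency_def V)
  show "weighted_adjacency f G $$ (i, j) \<ge> 0" if "i < n" "j < n" for i j
    using that f by (simp add: weighted_adjacency_def V)
  show "(\<Sum>j<n. weighted_adjacency f G $$ (i, j) * x j) = \<mu> * x i" if "i < n" for i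
    using that row by (simp add: weighted_adjacency_row_sum[OF V] N)
qed (use n pos in auto)

lemma rho_le_weighted_row_sum:
  fixes x :: "nat \<Rightarrow> real"
  assumes V: "pverts G = {..<n}" and n: "n > 0" and N: "\<And>i. i < n \<Longrightarrow> nbrs G i \<subseteq> {..<n}"
    and f: "\<And>a b. 0 \<le> a \<Longrightarrow> 0 \<le> b \<Longrightarrow> 0 \<le> f a b" and pos: "\<And>i. i < n \<Longrightarrow> x i > 0"
    and row: "\<And>i. i < n \<Longrightarrow>
      (\<Sum>j\<in>nbrs G i. f (real (degree_of G i)) (real (degree_of G j)) * x j) \<le> \<mu> * x i"
  shows "rho f G \<le> \<mu>"
  unfolding rho_def
proof (rule spectral_radius_le_weighted_row_sum[where n = n and x = x])
  show "weighted_adjacency f G \<in> carrier_mat n n" by (simp add: weighted_adjacency_def V)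
  show "weighted_adjacency f G $$ (i, j) \<ge> 0" if "i < n" "j < n" for i j
    using that f by (simp add: weighted_adjacency_def V)
  show "(\<Sum>j<n. weighted_adjacency f G $$ (i, j) * x j) \<le> \<mu> * x i" if "i < n" for i
    using that row by (simp add: weighted_adjacency_row_sum[OF V] N)
qed (use n pos in auto)

section \<open>Row sums for the test vector\<close>

text \<open>All values other than the largest one, \<open>m\<close>, are at most \<open>N - m\<close>. The resulting bound is convex in
  \<open>m\<close> and, for \<open>3 \<le> m \<le> K\<close>, largest at \<open>m = K\<close>.\<close>

lemma sum_quadratic_le:
  fixes y :: "'a \<Rightarrow> int"
  assumes A: "finite A" and y0: "\<And>k. k \<in> A \<Longrightarrow> 0 \<le> y k" and yK: "\<And>k. k \<in> A \<Longrightarrow> y k \<le> K"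
    and pair: "\<And>k l. k \<in> A \<Longrightarrow> l \<in> A \<Longrightarrow> k \<noteq> l \<Longrightarrow> y k + y l \<le> N"
    and total: "(\<Sum>k\<in>A. y k) \<le> S"
    and NS: "N + S \<le> 2 * K + 6" and KN: "K < N" and S: "S \<le> K * (K - 1) + (N - K - 1) * (S - K)"
  shows "(\<Sum>k\<in>A. y k * (y k - 1)) \<le> K * (K - 1) + (N - K - 1) * (S - K)"
proof (cases "\<exists>k\<in>A. y k \<ge> 3")
  case False
  \<comment> \<open>The values 0, 1, 2 satisfy \<open>y * (y - 1) \<le> y\<close>, so the total
    \<open>S\<close> bounds the sum.\<close>
  have "(\<Sum>k\<in>A. y k * (y k - 1)) \<le> (\<Sum>k\<in>A. y k)"
  proof (rule sum_mono)
    fix k assume "k \<in> A"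
    with False y0 have "y k = 0 \<or> y k = 1 \<or> y k = 2" by force
    then show "y k * (y k - 1) \<le> y k" by auto
  qed
  with total S show ?thesis by linarith
next
  case True
  then obtain m where m: "m \<in> A" "y m \<ge> 3" and mmax: "\<And>k. k \<in> A \<Longrightarrow> y k \<le> y m"
  proof -
    have fin: "finite (y ` A)" "y ` A \<noteq> {}" using A True by auto
    from Max_in[OF fin] obtain m where m: "m \<in> A" "y m = Max (y ` A)" by (metis imageE)
    then have "\<And>k. k \<in> A \<Longrightarrow> y k \<le> y m" using fin by simp
    with m True show ?thesis using that by (metis order_trans)
  qed
  let ?B = "A - {m}"
  have rest: "(\<Sum>k\<in>?B. y k) \<le> S - y m" using total A m by (simp add: sum.remove)
  have "(\<Sum>k\<in>?B. y k * (y k - 1)) \<le> (\<Sum>k\<in>?B. (N - y m - 1) * y k)"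
  proof (rule sum_mono)
    fix k assume k: "k \<in> ?B"
    with pair[of k m] m have "y k \<le> N - y m" by auto
    with y0[of k] k have "y k * (y k - 1) \<le> y k * (N - y m - 1)" by (intro mult_left_mono) auto
    then show "y k * (y k - 1) \<le> (N - y m - 1) * y k" by (simp add: mult.commute)
  qed
  also have "\<dots> = (N - y m - 1) * (\<Sum>k\<in>?B. y k)" by (simp add: sum_distrib_left)
  also have "\<dots> \<le> (N - y m - 1) * (S - y m)"
    using rest yK[OF m(1)] KN by (intro mult_left_mono) auto
  finally have "(\<Sum>k\<in>A. y k * (y k - 1)) \<le> y m * (y m - 1) + (N - y m - 1) * (S - y m)"
    using A m by (simp add: sum.remove)
  \<comment> \<open>The bounds at \<open>K\<close> and at the maximum \<open>y m\<close> differ by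
    this product. Its second factor is nonnegative by \<open>NS\<close> once
    \<open>y m \<ge> 3\<close>, which is why the cases split at 3.\<close>
  moreover have "0 \<le> (K - y m) * (2 * (K + y m) - (N + S))"
    using yK[OF m(1)] m(2) NS by (intro mult_nonneg_nonneg) auto
  moreover have "K * (K - 1) + (N - K - 1) * (S - K) - (y m * (y m - 1) + (N - y m - 1) * (S - y m))
    = (K - y m) * (2 * (K + y m) - (N + S))" by (simp add: algebra_simps)
  ultimately show ?thesis by linarith
qed

text \<open>The polynomials 1, y, y(y-1), (y+1)y(y-1) are the Newton basis for the nodes 0, 1, -1.
  Since y(y-1) is nonnegative, the cubic one is at most \<open>K + 1\<close> times the quadratic
  one, so two moments control the sum.\<close>

lemma row_sum_le_moments:
  fixes y :: "'a \<Rightarrow> real" and c0 c1 c2 c3 :: real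
  assumes g: "\<And>k. k \<in> A \<Longrightarrow>
      g k = c0 + c1 * y k + c2 * (y k * (y k - 1)) + c3 * ((y k + 1) * (y k * (y k - 1)))"
    and P0: "\<And>k. k \<in> A \<Longrightarrow> 0 \<le> y k * (y k - 1)" and yK: "\<And>k. k \<in> A \<Longrightarrow> y k \<le> K"
    and S: "(\<Sum>k\<in>A. y k) \<le> S" and P: "(\<Sum>k\<in>A. y k * (y k - 1)) \<le> P"
    and c: "0 \<le> c1" "0 \<le> c2" "0 \<le> c3" and K: "0 \<le> K"
  shows "(\<Sum>k\<in>A. g k) \<le> c0 * card A + c1 * S + (c2 + c3 * (K + 1)) * P"
proof -
  let ?P = "\<Sum>k\<in>A. y k * (y k - 1)"
  have "(\<Sum>k\<in>A. g k) \<le> (\<Sum>k\<in>A. c0 + c1 * y k + (c2 + c3 * (K + 1)) * (y k * (y k - 1)))"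
  proof (rule sum_mono)
    fix k assume k: "k \<in> A"
    have "c3 * ((y k + 1) * (y k * (y k - 1))) \<le> c3 * ((K + 1) * (y k * (y k - 1)))"
      using P0[OF k] yK[OF k] c by (intro mult_left_mono mult_right_mono) auto
    then show "g k \<le> c0 + c1 * y k + (c2 + c3 * (K + 1)) * (y k * (y k - 1))"
      unfolding g[OF k] by (simp add: algebra_simps)
  qed
  also have "\<dots> = c0 * card A + c1 * (\<Sum>k\<in>A. y k) + (c2 + c3 * (K + 1)) * ?P"
    by (simp add: sum.distrib sum_distrib_left)
  also have "\<dots> \<le> c0 * card A + c1 * S + (c2 + c3 * (K + 1)) * P"
    using S P c K by (intro add_mono order_refl mult_left_mono) auto
  finally show ?thesis .
qed

text \<open>The number \<open>c2 + c3 * (p + q + d)\<close> is the second divided difference of the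
  cubic at p, q, d. When it is nonnegative, \<open>F d\<close> does not exceed the chord through the
  two endpoints.\<close>

lemma nonpos_if_nonpos_at_endpoints:
  fixes F :: "real \<Rightarrow> real"
  assumes F: "\<And>d. F d = c0 + c1 * d + c2 * d\<^sup>2 + c3 * d ^ 3"
    and d: "p \<le> d" "d \<le> q" and ends: "F p \<le> 0" "F q \<le> 0" and convex: "0 \<le> c2 + c3 * (p + q + d)"
  shows "F d \<le> 0"
proof (cases "p < q")
  case True
  have "(q - p) * F d = (q - d) * F p + (d - p) * F q - (q - p) * (d - p) * (q - d) * (c2 + c3 * (p + q + d))"
    unfolding F by (simp add: algebra_simps power2_eq_square power3_eq_cube)
  moreover have "(q - d) * F p \<le> 0" "(d - p) * F q \<le> 0" using d ends by (auto intro!: mult_nonneg_nonpos)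
  moreover have "0 \<le> (q - p) * (d - p) * (q - d) * (c2 + c3 * (p + q + d))" using True d convex by simp
  ultimately have "(q - p) * F d \<le> 0" by linarith
  then show ?thesis using True by (simp add: mult_le_0_iff)
next
  case False
  then have "d = p" using d by simp
  with ends show ?thesis by simp
qed

text \<open>For a vertex of degree \<open>d\<close> in a graph of maximum degree at most \<open>n - 2\<close>, these are bounds for
  the numbers \<open>y\<^sub>u = d\<^sub>u - 1\<close> of its neighbours \<open>u\<close>: \<open>K\<close> for their maximum, \<open>S\<close> for \<open>\<Sum> y\<^sub>u\<close> and \<open>P\<close> for
  \<open>\<Sum> y\<^sub>u (y\<^sub>u - 1)\<close>. The largest admissible families are \<open>(n - 3, 3)\<close> for \<open>d = 2\<close>, \<open>(n - 3, 2, 1)\<close> for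
  \<open>d = 3\<close> (where \<open>P\<close> is not sharp) and \<open>(n + 1 - d, 1, 1, 0, \<dots>)\<close> for \<open>d \<ge> 4\<close>.\<close>

definition moment_bounds :: "real \<Rightarrow> real \<Rightarrow> real \<Rightarrow> real \<Rightarrow> real \<Rightarrow> bool" where
  "moment_bounds n d K S P \<longleftrightarrow>
    (d = 1 \<and> K = n - 3 \<and> S = n - 3 \<and> P = (n - 3) * (n - 4)) \<or>
    (d = 2 \<and> K = n - 3 \<and> S = n \<and> P = (n - 3) * (n - 4) + 6) \<or>
    (d = 3 \<and> K = n - 3 \<and> S = n \<and> P = (n - 3) * (n - 4) + 3) \<or>
    (4 \<le> d \<and> d \<le> n - 2 \<and> K = n + 1 - d \<and> S = n + 3 - d \<and> P = (n + 1 - d) * (n - d))"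

text \<open>Clears both denominators at once. It is applied with \<open>m = T\<^sup>2 - 2\<close>
  and \<open>B = T - 1\<close>, so that \<open>B / m\<close> is the slope \<open>b\<close> of the
  test vector.\<close>

lemma weighted_le_fracI:
  fixes m :: real
  assumes "0 < m" "0 < D" "D * (m * r + B * r') \<le> M * (m + B * e)"
  shows "r + B / m * r' \<le> M / D * (1 + B / m * e)"
proof -
  have "(m * D) * (r + B / m * r') = D * (m * r + B * r')"
    "(m * D) * (M / D * (1 + B / m * e)) = M * (m + B * e)"
    using assms by (simp_all add: field_simps)
  with assms(3) have "(m * D) * (r + B / m * r') \<le> (m * D) * (M / D * (1 + B / m * e))" by (simp only:)
  then show ?thesis by (rule mult_left_le_imp_le) (use assms in simp)
qed

text \<open>In the next three lemmas \<open>\<Delta>\<close> is the slack of the claim after clearing denominators. For each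
  fixed degree it is a polynomial in \<open>T\<close> whose expansion at the smallest admissible \<open>T\<close> has nonnegative
  coefficients; for \<open>d \<ge> 4\<close> it is concave in \<open>d\<close>, so that \<open>d = 4\<close> and \<open>d = n - 2 = T\<^sup>2 - 1\<close> suffice.\<close>

lemma row_bound_add:
  fixes T b d K S P :: real
  assumes T: "3 \<le> T" and b: "b = (T - 1) / (T\<^sup>2 - 2)"
    and bounds: "moment_bounds (T\<^sup>2 + 1) d K S P"
  shows "(d + 1) * d + (1 + b * (d + 2)) * S + b * P
    \<le> (T ^ 5 + T ^ 3 + 4 * T + 7) / T\<^sup>2 * (1 + b * (d - 1))"
proof -
  define t where "t = T - 3"
  have t: "0 \<le> t" using T by (simp add: t_def)
  have "2 * 2 \<le> T * T" using T by (intro mult_mono) auto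
  then have m: "0 < T\<^sup>2 - 2" by (simp add: power2_eq_square)
  \<comment> \<open>The row sum is written as \<open>r + b * r'\<close>, and \<open>x\<close> is the
    degree. Each case passes the \<open>r\<close> and \<open>r'\<close> obtained by substituting its
    \<open>K\<close>, \<open>S\<close> and \<open>P\<close>.\<close>
  define \<Delta> where "\<Delta> r r' x = (T ^ 5 + T ^ 3 + 4 * T + 7) * (T\<^sup>2 - 2 + (T - 1) * (x - 1))
    - T\<^sup>2 * ((T\<^sup>2 - 2) * r + (T - 1) * r')" for r r' x
  have reduce: "r + b * r' \<le> (T ^ 5 + T ^ 3 + 4 * T + 7) / T\<^sup>2 * (1 + b * (x - 1))"
    if "0 \<le> \<Delta> r r' x" for r r' x
    using that T weighted_le_fracI[OF m, of "T\<^sup>2" r "T - 1" r' "T ^ 5 + T ^ 3 + 4 * T + 7" "x - 1"]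
    unfolding b \<Delta>_def by simp
  note expand = t_def algebra_simps power_numeral_reduce
  from bounds consider
      (1) "d = 1" "K = T\<^sup>2 - 2" "S = T\<^sup>2 - 2" "P = (T\<^sup>2 - 2) * (T\<^sup>2 - 3)"
    | (2) "d = 2" "K = T\<^sup>2 - 2" "S = T\<^sup>2 + 1" "P = (T\<^sup>2 - 2) * (T\<^sup>2 - 3) + 6"
    | (3) "d = 3" "K = T\<^sup>2 - 2" "S = T\<^sup>2 + 1" "P = (T\<^sup>2 - 2) * (T\<^sup>2 - 3) + 3"
    | (4) "4 \<le> d" "d \<le> T\<^sup>2 - 1" "K = T\<^sup>2 + 2 - d" "S = T\<^sup>2 + 4 - d"
        "P = (T\<^sup>2 + 2 - d) * (T\<^sup>2 + 1 - d)"
    unfolding moment_bounds_def by (auto simp: algebra_simps)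
  then show ?thesis
  proof cases
    case 1
    have "\<Delta> (T\<^sup>2) (T ^ 4 - 2 * T\<^sup>2) 1
      = 322 + 493 * t + 295 * t ^ 2 + 92 * t ^ 3 + 15 * t ^ 4 + t ^ 5"
      unfolding \<Delta>_def by (simp add: expand)
    also have "\<dots> \<ge> 0" using t by simp
    finally show ?thesis using reduce[of "T\<^sup>2" "T ^ 4 - 2 * T\<^sup>2" 1]
      unfolding 1 by (simp add: algebra_simps power_numeral_reduce)
  next
    case 2
    have "\<Delta> (T\<^sup>2 + 7) (T ^ 4 - T\<^sup>2 + 16) 2
      = 9 + 349 * t + 581 * t ^ 2 + 375 * t ^ 3 + 115 * t ^ 4 + 17 * t ^ 5 + t ^ 6"
      unfolding \<Delta>_def by (simp add: expand)
    also have "\<dots> \<ge> 0" using t by simp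
    finally show ?thesis using reduce[of "T\<^sup>2 + 7" "T ^ 4 - T\<^sup>2 + 16" 2]
      unfolding 2 by (simp add: algebra_simps power_numeral_reduce)
  next
    case 3
    have "\<Delta> (T\<^sup>2 + 13) (T ^ 4 + 14) 3
      = 83 + 679 * t + 1063 * t ^ 2 + 688 * t ^ 3 + 216 * t ^ 4 + 33 * t ^ 5 + 2 * t ^ 6"
      unfolding \<Delta>_def by (simp add: expand)
    also have "\<dots> \<ge> 0" using t by simp
    finally show ?thesis using reduce[of "T\<^sup>2 + 13" "T ^ 4 + 14" 3]
      unfolding 3 by (simp add: algebra_simps power_numeral_reduce)
  next
    case 4
    \<comment> \<open>The slack with its sign flipped: nonnegative slack becomes
      \<open>F d \<le> 0\<close>, and concavity becomes the convexity that the endpoint lemma asks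
      for.\<close>
    define F where "F x = - \<Delta> (x\<^sup>2 + T\<^sup>2 + 4) (- (T\<^sup>2 + 1) * x + T ^ 4 + 5 * T\<^sup>2 + 10) x" for x
    have "F 4 = - (202 + 1039 * t + 1541 * t ^ 2 + 995 * t ^ 3 + 316 * t ^ 4 + 49 * t ^ 5
      + 3 * t ^ 6)"
      unfolding F_def \<Delta>_def by (simp add: expand)
    also have "\<dots> \<le> 0" using t by (simp only: neg_le_0_iff_le) simp
    finally have F4: "F 4 \<le> 0" by simp
    have "F (T\<^sup>2 - 1) = - (210 + 847 * t + 1057 * t ^ 2 + 626 * t ^ 3 + 195 * t ^ 4 + 31 * t ^ 5
      + 2 * t ^ 6)"
      unfolding F_def \<Delta>_def by (simp add: expand)
    also have "\<dots> \<le> 0" using t by (simp only: neg_le_0_iff_le) simp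
    finally have Ftop: "F (T\<^sup>2 - 1) \<le> 0" by simp
    have F: "F x = (T ^ 6 + 5 * T ^ 5 - 2 * T ^ 4 + 7 * T ^ 3 - 21 * T\<^sup>2 + 11 * T + 7) + (7 - T ^ 6 - 3 * T\<^sup>2 - 3 * T) * x
      + (T ^ 4 - 2 * T\<^sup>2) * x\<^sup>2 + 0 * x ^ 3" for x
      unfolding F_def \<Delta>_def by (simp add: algebra_simps power_numeral_reduce)
    have "F d \<le> 0"
    proof (rule nonpos_if_nonpos_at_endpoints[OF F 4(1,2) F4 Ftop])
      have "T ^ 4 - 2 * T\<^sup>2 = T\<^sup>2 * (T\<^sup>2 - 2)" by (simp add: algebra_simps power_numeral_reduce)
      then show "0 \<le> (T ^ 4 - 2 * T\<^sup>2) + 0 * (4 + (T\<^sup>2 - 1) + d)" using m by simp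
    qed
    then show ?thesis using reduce[of "d\<^sup>2 + T\<^sup>2 + 4" "- (T\<^sup>2 + 1) * d + T ^ 4 + 5 * T\<^sup>2 + 10" d]
      unfolding 4 F_def by (simp add: algebra_simps power_numeral_reduce)
  qed
qed

lemma row_bound_sum_square:
  fixes T b d K S P :: real
  assumes T: "11 / 4 \<le> T" and b: "b = (T - 1) / (T\<^sup>2 - 2)"
    and bounds: "moment_bounds (T\<^sup>2 + 1) d K S P"
  shows "(d + 1)\<^sup>2 * d + (2 * (d + 1) + 1 + b * (d + 2)\<^sup>2) * S + (1 + 2 * b * (d + 1) + b * (K + 1)) * P
    \<le> T * ((T\<^sup>2 + 1)\<^sup>2 + 8) * (1 + b * (d - 1))"
proof -
  \<comment> \<open>Scaling by 4 keeps the coefficients integral; the factors 1024 and 4096 below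
    are 4^5 and 4^6 and clear the denominators of polynomials of degree 5 and 6 in T.\<close>
  define t where "t = 4 * T - 11"
  have t: "0 \<le> t" using T by (simp add: t_def)
  have "2 * 2 \<le> T * T" using T by (intro mult_mono) auto
  then have m: "0 < T\<^sup>2 - 2" by (simp add: power2_eq_square)
  define \<Delta> where "\<Delta> r r' x = (T * ((T\<^sup>2 + 1)\<^sup>2 + 8)) * (T\<^sup>2 - 2 + (T - 1) * (x - 1))
    - ((T\<^sup>2 - 2) * r + (T - 1) * r')" for r r' x
  have reduce: "r + b * r' \<le> T * ((T\<^sup>2 + 1)\<^sup>2 + 8) * (1 + b * (x - 1))"
    if "0 \<le> \<Delta> r r' x" for r r' x
    using that T weighted_le_fracI[OF m, of "1" r "T - 1" r' "T * ((T\<^sup>2 + 1)\<^sup>2 + 8)" "x - 1"]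
    unfolding b \<Delta>_def by simp
  note expand = t_def algebra_simps power_numeral_reduce
  from bounds consider
      (1) "d = 1" "K = T\<^sup>2 - 2" "S = T\<^sup>2 - 2" "P = (T\<^sup>2 - 2) * (T\<^sup>2 - 3)"
    | (2) "d = 2" "K = T\<^sup>2 - 2" "S = T\<^sup>2 + 1" "P = (T\<^sup>2 - 2) * (T\<^sup>2 - 3) + 6"
    | (3) "d = 3" "K = T\<^sup>2 - 2" "S = T\<^sup>2 + 1" "P = (T\<^sup>2 - 2) * (T\<^sup>2 - 3) + 3"
    | (4) "4 \<le> d" "d \<le> T\<^sup>2 - 1" "K = T\<^sup>2 + 2 - d" "S = T\<^sup>2 + 4 - d"
        "P = (T\<^sup>2 + 2 - d) * (T\<^sup>2 + 1 - d)"
    unfolding moment_bounds_def by (auto simp: algebra_simps)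
  then show ?thesis
  proof cases
    case 1
    have "1024 * \<Delta> (T ^ 4) (T ^ 6 - 2 * T ^ 4) 1
      = 377894 + 170842 * t + 29260 * t ^ 2 + 2500 * t ^ 3 + 110 * t ^ 4 + 2 * t ^ 5"
      unfolding \<Delta>_def by (simp add: expand)
    also have "\<dots> \<ge> 0" using t by simp
    finally show ?thesis using reduce[of "T ^ 4" "T ^ 6 - 2 * T ^ 4" 1]
      unfolding 1 by (simp add: algebra_simps power_numeral_reduce)
  next
    case 2
    have "4096 * \<Delta> (T ^ 4 + 2 * T\<^sup>2 + 37) (T ^ 6 + 3 * T\<^sup>2 + 76) 2
      = 399581 + 620110 * t + 184231 * t ^ 2 + 23188 * t ^ 3 + 1627 * t ^ 4 + 62 * t ^ 5
      + t ^ 6"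
      unfolding \<Delta>_def by (simp add: expand)
    also have "\<dots> \<ge> 0" using t by simp
    finally show ?thesis using reduce[of "T ^ 4 + 2 * T\<^sup>2 + 37" "T ^ 6 + 3 * T\<^sup>2 + 76" 2]
      unfolding 2 by (simp add: algebra_simps power_numeral_reduce)
  next
    case 3
    have "4096 * \<Delta> (T ^ 4 + 4 * T\<^sup>2 + 66) (T ^ 6 + 2 * T ^ 4 - T\<^sup>2 + 88) 3
      = 308066 + 790644 * t + 266462 * t ^ 2 + 36824 * t ^ 3 + 2814 * t ^ 4
      + 116 * t ^ 5 + 2 * t ^ 6"
      unfolding \<Delta>_def by (simp add: expand)
    also have "\<dots> \<ge> 0" using t by simp
    finally show ?thesis using reduce[of "T ^ 4 + 4 * T\<^sup>2 + 66" "T ^ 6 + 2 * T ^ 4 - T\<^sup>2 + 88" 3]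
      unfolding 3 by (simp add: algebra_simps power_numeral_reduce)
  next
    case 4
    define F where "F x = - \<Delta> (x ^ 3 + x\<^sup>2 + 3 * x + T ^ 4 + 6 * T\<^sup>2 + 14) (2 * x\<^sup>2 - (T ^ 4 + 6 * T\<^sup>2 + 1) * x + T ^ 6 + 8 * T ^ 4 + 21 * T\<^sup>2 + 26) x" for x
    have "4096 * F 4 = - (187239 + 911130 * t + 342165 * t ^ 2 + 50332 * t ^ 3 + 4001 * t ^ 4
      + 170 * t ^ 5 + 3 * t ^ 6)"
      unfolding F_def \<Delta>_def by (simp add: expand)
    also have "\<dots> \<le> 0" using t by (simp only: neg_le_0_iff_le) simp
    finally have F4: "F 4 \<le> 0" by simp
    have "4096 * F (T\<^sup>2 - 1) = - (36031 + 796866 * t + 326277 * t ^ 2 + 52844 * t ^ 3 + 4313 * t ^ 4 + 178 * t ^ 5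
      + 3 * t ^ 6)"
      unfolding F_def \<Delta>_def by (simp add: expand)
    also have "\<dots> \<le> 0" using t by (simp only: neg_le_0_iff_le) simp
    finally have Ftop: "F (T\<^sup>2 - 1) \<le> 0" by simp
    have F: "F x = (T ^ 6 + 7 * T ^ 5 - 2 * T ^ 4 + 14 * T ^ 3 - 10 * T\<^sup>2 + 35 * T - 54) + (8 * T - T ^ 6 - T ^ 4 - 4 * T ^ 3 - 5) * x
      + (T\<^sup>2 + 2 * T - 4) * x\<^sup>2 + (T\<^sup>2 - 2) * x ^ 3" for x
      unfolding F_def \<Delta>_def by (simp add: algebra_simps power_numeral_reduce)
    have "F d \<le> 0"
    proof (rule nonpos_if_nonpos_at_endpoints[OF F 4(1,2) F4 Ftop])
      have "16 * (T\<^sup>2 + 2 * T - 4) = 145 + 30 * t + t ^ 2" by (simp add: expand)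
      also have "\<dots> \<ge> 0" using t by simp
      finally have c2: "0 \<le> T\<^sup>2 + 2 * T - 4" by simp
      have "16 * (T\<^sup>2 - 2) = 89 + 22 * t + t ^ 2" by (simp add: expand)
      also have "\<dots> \<ge> 0" using t by simp
      finally have c3: "0 \<le> T\<^sup>2 - 2" by simp
      show "0 \<le> (T\<^sup>2 + 2 * T - 4) + (T\<^sup>2 - 2) * (4 + (T\<^sup>2 - 1) + d)"
        using 4(1) m c2 c3 by (intro add_nonneg_nonneg mult_nonneg_nonneg) auto
    qed
    then show ?thesis using reduce[of "d ^ 3 + d\<^sup>2 + 3 * d + T ^ 4 + 6 * T\<^sup>2 + 14" "2 * d\<^sup>2 - (T ^ 4 + 6 * T\<^sup>2 + 1) * d + T ^ 6 + 8 * T ^ 4 + 21 * T\<^sup>2 + 26" d]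
      unfolding 4 F_def by (simp add: algebra_simps power_numeral_reduce)
  qed
qed

lemma row_bound_squares_sum:
  fixes T b d K S P :: real
  assumes T: "5 / 2 \<le> T" and b: "b = (T - 1) / (T\<^sup>2 - 2)"
    and bounds: "moment_bounds (T\<^sup>2 + 1) d K S P"
  shows "(d\<^sup>2 + 1) * d + (3 + b * (d\<^sup>2 + 4)) * S + (1 + 2 * b + b * (K + 1)) * P
    \<le> T * (T ^ 4 + 1) * (1 + b * (d - 1))"
proof -
  define t where "t = 2 * T - 5"
  have t: "0 \<le> t" using T by (simp add: t_def)
  have "2 * 2 \<le> T * T" using T by (intro mult_mono) auto
  then have m: "0 < T\<^sup>2 - 2" by (simp add: power2_eq_square)
  define \<Delta> where "\<Delta> r r' x = (T * (T ^ 4 + 1)) * (T\<^sup>2 - 2 + (T - 1) * (x - 1))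
    - ((T\<^sup>2 - 2) * r + (T - 1) * r')" for r r' x
  have reduce: "r + b * r' \<le> T * (T ^ 4 + 1) * (1 + b * (x - 1))"
    if "0 \<le> \<Delta> r r' x" for r r' x
    using that T weighted_le_fracI[OF m, of "1" r "T - 1" r' "T * (T ^ 4 + 1)" "x - 1"]
    unfolding b \<Delta>_def by simp
  note expand = t_def algebra_simps power_numeral_reduce
  from bounds consider
      (1) "d = 1" "K = T\<^sup>2 - 2" "S = T\<^sup>2 - 2" "P = (T\<^sup>2 - 2) * (T\<^sup>2 - 3)"
    | (2) "d = 2" "K = T\<^sup>2 - 2" "S = T\<^sup>2 + 1" "P = (T\<^sup>2 - 2) * (T\<^sup>2 - 3) + 6"
    | (3) "d = 3" "K = T\<^sup>2 - 2" "S = T\<^sup>2 + 1" "P = (T\<^sup>2 - 2) * (T\<^sup>2 - 3) + 3"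
    | (4) "4 \<le> d" "d \<le> T\<^sup>2 - 1" "K = T\<^sup>2 + 2 - d" "S = T\<^sup>2 + 4 - d"
        "P = (T\<^sup>2 + 2 - d) * (T\<^sup>2 + 1 - d)"
    unfolding moment_bounds_def by (auto simp: algebra_simps)
  then show ?thesis
  proof cases
    case 1
    have "32 * \<Delta> (T ^ 4 - 2 * T\<^sup>2 + 2) (T ^ 6 - 4 * T ^ 4 + 6 * T\<^sup>2 - 4) 1
      = 3910 + 4782 * t + 2200 * t ^ 2 + 480 * t ^ 3 + 50 * t ^ 4 + 2 * t ^ 5"
      unfolding \<Delta>_def by (simp add: expand)
    also have "\<dots> \<ge> 0" using t by simp
    finally show ?thesis using reduce[of "T ^ 4 - 2 * T\<^sup>2 + 2" "T ^ 6 - 4 * T ^ 4 + 6 * T\<^sup>2 - 4" 1]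
      unfolding 1 by (simp add: algebra_simps power_numeral_reduce)
  next
    case 2
    have "64 * \<Delta> (T ^ 4 - 2 * T\<^sup>2 + 25) (T ^ 6 - 4 * T ^ 4 + 15 * T\<^sup>2 + 20) 2
      = 3475 + 13784 * t + 9987 * t ^ 2 + 2888 * t ^ 3 + 425 * t ^ 4 + 32 * t ^ 5
      + t ^ 6"
      unfolding \<Delta>_def by (simp add: expand)
    also have "\<dots> \<ge> 0" using t by simp
    finally show ?thesis using reduce[of "T ^ 4 - 2 * T\<^sup>2 + 25" "T ^ 6 - 4 * T ^ 4 + 15 * T\<^sup>2 + 20" 2]
      unfolding 2 by (simp add: algebra_simps power_numeral_reduce)
  next
    case 3
    have "64 * \<Delta> (T ^ 4 - 2 * T\<^sup>2 + 42) (T ^ 6 - 4 * T ^ 4 + 17 * T\<^sup>2 + 22) 3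
      = 7074 + 22748 * t + 16398 * t ^ 2 + 4872 * t ^ 3 + 750 * t ^ 4 + 60 * t ^ 5
      + 2 * t ^ 6"
      unfolding \<Delta>_def by (simp add: expand)
    also have "\<dots> \<ge> 0" using t by simp
    finally show ?thesis using reduce[of "T ^ 4 - 2 * T\<^sup>2 + 42" "T ^ 6 - 4 * T ^ 4 + 17 * T\<^sup>2 + 22" 3]
      unfolding 3 by (simp add: algebra_simps power_numeral_reduce)
  next
    case 4
    define F where "F x = - \<Delta> (x ^ 3 + x\<^sup>2 - (2 * T\<^sup>2 + 5) * x + T ^ 4 + 6 * T\<^sup>2 + 14) (- 2 * x ^ 3 + (4 * T\<^sup>2 + 12) * x\<^sup>2 - (3 * T ^ 4 + 16 * T\<^sup>2 + 21) * x + T ^ 6 + 8 * T ^ 4 + 21 * T\<^sup>2 + 26) x" for x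
    have "64 * F 4 = - (7121 + 29008 * t + 22361 * t ^ 2 + 6840 * t ^ 3 + 1075 * t ^ 4 + 88 * t ^ 5
      + 3 * t ^ 6)"
      unfolding F_def \<Delta>_def by (simp add: expand)
    also have "\<dots> \<le> 0" using t by (simp only: neg_le_0_iff_le) simp
    finally have F4: "F 4 \<le> 0" by simp
    have "64 * F (T\<^sup>2 - 1) = - (3001 + 17368 * t + 14057 * t ^ 2 + 4760 * t ^ 3 + 859 * t ^ 4 + 80 * t ^ 5
      + 3 * t ^ 6)"
      unfolding F_def \<Delta>_def by (simp add: expand)
    also have "\<dots> \<le> 0" using t by (simp only: neg_le_0_iff_le) simp
    finally have Ftop: "F (T\<^sup>2 - 1) \<le> 0" by simp
    have F: "F x = (T ^ 6 + 9 * T ^ 5 - 4 * T ^ 4 + 20 * T ^ 3 - 18 * T\<^sup>2 + 27 * T - 54) + (T ^ 4 - T ^ 6 - 2 * T ^ 5 - 16 * T ^ 3 + 14 * T\<^sup>2 - 20 * T + 31) * x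
      + (4 * T ^ 3 - 3 * T\<^sup>2 + 12 * T - 14) * x\<^sup>2 + (T\<^sup>2 - 2 * T) * x ^ 3" for x
      unfolding F_def \<Delta>_def by (simp add: algebra_simps power_numeral_reduce)
    have "F d \<le> 0"
    proof (rule nonpos_if_nonpos_at_endpoints[OF F 4(1,2) F4 Ftop])
      have "8 * (4 * T ^ 3 - 3 * T\<^sup>2 + 12 * T - 14) = 478 + 288 * t + 54 * t ^ 2 + 4 * t ^ 3" by (simp add: expand)
      also have "\<dots> \<ge> 0" using t by simp
      finally have c2: "0 \<le> 4 * T ^ 3 - 3 * T\<^sup>2 + 12 * T - 14" by simp
      have "4 * (T\<^sup>2 - 2 * T) = 5 + 6 * t + t ^ 2" by (simp add: expand)
      also have "\<dots> \<ge> 0" using t by simp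
      finally have c3: "0 \<le> T\<^sup>2 - 2 * T" by simp
      show "0 \<le> (4 * T ^ 3 - 3 * T\<^sup>2 + 12 * T - 14) + (T\<^sup>2 - 2 * T) * (4 + (T\<^sup>2 - 1) + d)"
        using 4(1) m c2 c3 by (intro add_nonneg_nonneg mult_nonneg_nonneg) auto
    qed
    then show ?thesis using reduce[of "d ^ 3 + d\<^sup>2 - (2 * T\<^sup>2 + 5) * d + T ^ 4 + 6 * T\<^sup>2 + 14" "- 2 * d ^ 3 + (4 * T\<^sup>2 + 12) * d\<^sup>2 - (3 * T ^ 4 + 16 * T\<^sup>2 + 21) * d + T ^ 6 + 8 * T ^ 4 + 21 * T\<^sup>2 + 26" d]
      unfolding 4 F_def by (simp add: algebra_simps power_numeral_reduce)
  qed
qed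

section \<open>Degrees in bicyclic graphs\<close>

lemma finite_parcs:
  assumes "bicyclic G" shows "finite (parcs G)" "finite (pverts G)"
  using assms pair_fin_digraph.pair_finite_arcs pair_fin_digraph.pair_finite_verts
  unfolding bicyclic_def pair_graph_def pair_digraph_def by auto

lemma parcs_symmetric:
  assumes "bicyclic G" "(u, v) \<in> parcs G" shows "(v, u) \<in> parcs G"
  using assms unfolding bicyclic_def pair_graph_def pair_pseudo_graph_def
  by (auto dest!: pair_sym_digraph.pair_sym_arcs simp: symmetric_def sym_def)

lemma parcs_irreflexive:
  assumes "bicyclic G" "(u, v) \<in> parcs G" shows "u \<noteq> v"
  using assms unfolding bicyclic_def pair_graph_def pair_digraph_def
  by (auto dest: pair_loopfree_digraph.pair_no_loops)

lemma parcs_subset: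
  assumes "bicyclic G" "(u, v) \<in> parcs G" shows "u \<in> pverts G" "v \<in> pverts G"
  using assms unfolding bicyclic_def pair_graph_def pair_digraph_def pair_fin_digraph_def
  by (auto dest: pair_wf_digraph.arc_fst_in_verts pair_wf_digraph.arc_snd_in_verts)

lemma nbrs_subset:
  assumes "bicyclic G" shows "nbrs G v \<subseteq> pverts G - {v}"
  using parcs_subset[OF assms] parcs_irreflexive[OF assms] by (fastforce simp: nbrs_def)

lemma finite_nbrs: "bicyclic G \<Longrightarrow> finite (nbrs G v)"
  using nbrs_subset finite_parcs(2) by (metis finite_Diff finite_subset)

lemma card_parcs:
  assumes G: "bicyclic G" shows "card (parcs G) = 2 * (card (pverts G) + 1)"
proof -
  have eq: "parcs G = (\<Union>e\<in>uedges G. {(u, v). {u, v} = e \<and> (u, v) \<in> parcs G})"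
    by (auto simp: uedges_def)
  have two: "card {(u, v). {u, v} = e \<and> (u, v) \<in> parcs G} = 2" if e: "e \<in> uedges G" for e
  proof -
    from e obtain u v where uv: "e = {u, v}" "(u, v) \<in> parcs G" by (auto simp: uedges_def)
    then have "{(u, v). {u, v} = e \<and> (u, v) \<in> parcs G} = {(u, v), (v, u)}"
      using parcs_symmetric[OF G] by (auto simp: doubleton_eq_iff)
    moreover have "u \<noteq> v" using parcs_irreflexive[OF G uv(2)] .
    ultimately show ?thesis by simp
  qed
  have "finite (uedges G)"
  proof -
    have "uedges G = (\<lambda>(u, v). {u, v}) ` parcs G" by (auto simp: uedges_def)
    then show ?thesis using finite_parcs(1)[OF G] by simp
  qed
  then have "card (\<Union>e\<in>uedges G. {(u, v). {u, v} = e \<and> (u, v) \<in> parcs G})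
    = (\<Sum>e\<in>uedges G. card {(u, v). {u, v} = e \<and> (u, v) \<in> parcs G})"
    using finite_parcs(1)[OF G]
    by (intro card_UN_disjoint) (auto intro: finite_subset[of _ "parcs G"])
  then show ?thesis using eq two G by (simp add: bicyclic_def)
qed

lemma sum_degrees:
  assumes G: "bicyclic G"
  shows "(\<Sum>v\<in>pverts G. card (nbrs G v)) = 2 * (card (pverts G) + 1)"
proof -
  have "parcs G = Sigma (pverts G) (nbrs G)" using parcs_subset[OF G] by (auto simp: nbrs_def)
  then show ?thesis
    using card_parcs[OF G] finite_parcs(2)[OF G] finite_nbrs[OF G] by simp
qed

text \<open>The arcs leaving \<open>S\<close> and their reversals lie among all
  \<open>2 * (n + 1)\<close> arcs. Only arcs inside \<open>S\<close> are counted twice, and there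
  are at most \<open>card S * (card S - 1)\<close> of them.\<close>

lemma sum_degrees_subset:
  assumes G: "bicyclic G" and S: "S \<subseteq> pverts G"
  shows "2 * (\<Sum>v\<in>S. card (nbrs G v)) \<le> 2 * (card (pverts G) + 1) + card S * (card S - 1)"
proof -
  have fS: "finite S" using S finite_parcs(2)[OF G] by (rule finite_subset)
  define A where "A = Sigma S (nbrs G)"
  have A: "finite A" "A \<subseteq> parcs G" "card A = (\<Sum>v\<in>S. card (nbrs G v))"
    using fS finite_nbrs[OF G] by (auto simp: A_def nbrs_def)
  have "card A + card (A\<inverse>) = card (A \<union> A\<inverse>) + card (A \<inter> A\<inverse>)"
    using A(1) by (intro card_Un_Int) auto
  moreover have "card (A \<union> A\<inverse>) \<le> card (parcs G)"
    using A parcs_symmetric[OF G] finite_parcs(1)[OF G] by (intro card_mono) auto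
  moreover have "card (A \<inter> A\<inverse>) \<le> card (SIGMA u:S. S - {u})"
    using fS nbrs_subset[OF G] by (intro card_mono) (auto simp: A_def)
  moreover have "card (SIGMA u:S. S - {u}) = card S * (card S - 1)"
    using fS by simp
  moreover have "card (A\<inverse>) = card A" by simp
  ultimately show ?thesis using A(3) card_parcs[OF G] by simp
qed

lemma nbrs_nonempty:
  assumes G: "bicyclic G" and n: "2 \<le> card (pverts G)" and v: "v \<in> pverts G"
  shows "nbrs G v \<noteq> {}"
proof -
  have "pverts G \<noteq> {v}" using n by auto
  then obtain w where w: "w \<in> pverts G" "w \<noteq> v" using v by blast
  \<comment> \<open>Connectedness is defined through the symmetric closure, which adds nothing here;
    the first arc of a walk from \<open>v\<close> to \<open>w\<close> then provides a
    neighbour.\<close>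
  have "parcs (mk_symmetric (with_proj G)) = parcs G"
    using parcs_symmetric[OF G] by (auto simp: parcs_mk_symmetric)
  moreover have "v \<rightarrow>\<^sup>*\<^bsub>with_proj (mk_symmetric (with_proj G))\<^esub> w"
    using G v w unfolding bicyclic_def connected_def by auto
  ultimately have "(v, w) \<in> rtrancl_on (pverts G) (parcs G)"
    by (simp add: reachable_def)
  then have "(v, w) \<in> (parcs G)\<^sup>*" by (rule rtrancl_on_rtranclI)
  then show ?thesis using w(2) by (auto simp: nbrs_def elim: converse_rtranclE)
qed

text \<open>Two caps on \<open>y\<close> compete: \<open>n - 3\<close> from the maximum degree and
  \<open>n + 1 - d\<close> from counting edges at \<open>v\<close> and one neighbour. They agree at
  degree 4, where the regime changes. For degree 2 the pair bound gives a smaller \<open>S\<close>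
  than the total count.\<close>

lemma nbr_moments:
  fixes n :: nat
  assumes G: "bicyclic G" and n: "n = card (pverts G)" "8 \<le> n" and v: "v \<in> pverts G"
    and max: "\<And>u. u \<in> pverts G \<Longrightarrow> card (nbrs G u) \<le> n - 2"
  obtains K S P :: real where
    "moment_bounds n (card (nbrs G v)) K S P"
    "\<And>u. u \<in> nbrs G v \<Longrightarrow> real (card (nbrs G u)) - 1 \<le> K"
    "(\<Sum>u\<in>nbrs G v. real (card (nbrs G u)) - 1) \<le> S"
    "(\<Sum>u\<in>nbrs G v. (real (card (nbrs G u)) - 1) * (real (card (nbrs G u)) - 1 - 1)) \<le> P"
proof -
  note result = that
  let ?N = "nbrs G v"
  define d where "d = int (card ?N)"
  define y where "y u = int (card (nbrs G u)) - 1" for u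
  note sub = nbrs_subset[OF G] and fin = finite_nbrs[OF G]
  have deg1: "1 \<le> card (nbrs G u)" if "u \<in> pverts G" for u
    using nbrs_nonempty[OF G _ that] n fin by (simp add: Suc_le_eq card_gt_0_iff)
  have N: "?N \<subseteq> pverts G" "v \<notin> ?N" using sub by auto
  have d: "1 \<le> d" "d \<le> int n - 2" using deg1[OF v] max[OF v] n by (auto simp: d_def)
  have y0: "0 \<le> y u" and yn: "y u \<le> int n - 3" if "u \<in> ?N" for u
    using that N deg1[of u] max[of u] n by (auto simp: y_def)
  have yd: "y u \<le> int n + 1 - d" if "u \<in> ?N" for u
  proof -
    have "u \<noteq> v" using that N by auto
    moreover have "2 * (\<Sum>w\<in>{v, u}. card (nbrs G w)) \<le> 2 * (n + 1) + card {v, u} * (card {v, u} - 1)"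
      unfolding n(1) using that N v by (intro sum_degrees_subset[OF G]) auto
    ultimately show ?thesis by (auto simp: y_def d_def)
  qed
  have pair: "y u + y w \<le> int n + 2 - d" if "u \<in> ?N" "w \<in> ?N" "u \<noteq> w" for u w
  proof -
    have "u \<noteq> v" "w \<noteq> v" using that N by auto
    moreover have "2 * (\<Sum>x\<in>{v, u, w}. card (nbrs G x))
        \<le> 2 * (n + 1) + card {v, u, w} * (card {v, u, w} - 1)"
      unfolding n(1) using that N v by (intro sum_degrees_subset[OF G]) auto
    ultimately show ?thesis using that(3) by (auto simp: y_def d_def)
  qed
  \<comment> \<open>The \<open>n - 1 - d\<close> vertices outside the closed neighbourhood have
    degree at least 1, which leaves at most \<open>2 * (n + 1) - d - (n - 1 - d) = n + 3\<close> for
    the degrees of the neighbours.\<close>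
  have total: "(\<Sum>u\<in>?N. y u) \<le> int n + 3 - d"
  proof -
    let ?R = "pverts G - insert v ?N"
    have fV: "finite (pverts G)" by (rule finite_parcs(2)[OF G])
    have cR: "card ?R = n - (card ?N + 1)"
      using N v fin fV n by (subst card_Diff_subset) auto
    have le: "card ?N + 1 \<le> n"
      using card_mono[OF fV, of "insert v ?N"] N v fin n by simp
    have "(\<Sum>u\<in>pverts G. card (nbrs G u)) = (\<Sum>u\<in>?R. card (nbrs G u)) + (\<Sum>u\<in>insert v ?N. card (nbrs G u))"
      using N v fV by (intro sum.subset_diff) auto
    then have "(\<Sum>u\<in>?R. card (nbrs G u)) + (card ?N + (\<Sum>u\<in>?N. card (nbrs G u))) = 2 * (n + 1)"
      using sum_degrees[OF G] N fin n by simp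
    moreover have "card ?R \<le> (\<Sum>u\<in>?R. card (nbrs G u))"
      using sum_mono[of ?R "\<lambda>_. 1" "\<lambda>u. card (nbrs G u)"] deg1 by simp
    moreover have "s \<le> n + 3"
      if "r + (c + s) = 2 * (n + 1)" "k \<le> r" "k = n - (c + 1)" "c + 1 \<le> n" for r c s k
      using that by arith
    ultimately have "(\<Sum>u\<in>?N. card (nbrs G u)) \<le> n + 3" using cR le by blast
    then have "int (\<Sum>u\<in>?N. card (nbrs G u)) \<le> int n + 3" by linarith
    then show ?thesis by (simp add: y_def d_def sum_subtractf)
  qed
  have main: thesis if mb: "moment_bounds n (card ?N) (real_of_int K) (real_of_int S) (real_of_int P)"
    and K: "\<And>u. u \<in> ?N \<Longrightarrow> y u \<le> K" and S: "(\<Sum>u\<in>?N. y u) \<le> S"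
    and P: "(\<Sum>u\<in>?N. y u * (y u - 1)) \<le> P" for K S P
  proof (rule result[OF mb])
    have ry: "real_of_int (y u) = real (card (nbrs G u)) - 1" for u by (simp add: y_def)
    show "real (card (nbrs G u)) - 1 \<le> real_of_int K" if "u \<in> ?N" for u
      using K[OF that] unfolding ry[symmetric] by simp
    show "(\<Sum>u\<in>?N. real (card (nbrs G u)) - 1) \<le> real_of_int S"
      using S unfolding ry[symmetric] by (simp flip: of_int_sum)
    have "real_of_int (\<Sum>u\<in>?N. y u * (y u - 1)) \<le> real_of_int P" using P by (simp only: of_int_le_iff)
    then show "(\<Sum>u\<in>?N. (real (card (nbrs G u)) - 1) * (real (card (nbrs G u)) - 1 - 1)) \<le> real_of_int P"
      by (simp add: ry)
  qed
  have quad: "(\<Sum>u\<in>?N. y u * (y u - 1)) \<le> K * (K - 1) + (M - K - 1) * (S - K)"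
    if "\<And>u. u \<in> ?N \<Longrightarrow> y u \<le> K" "(\<Sum>u\<in>?N. y u) \<le> S" "M + S \<le> 2 * K + 6" "K < M"
      "\<And>u w. u \<in> ?N \<Longrightarrow> w \<in> ?N \<Longrightarrow> u \<noteq> w \<Longrightarrow> y u + y w \<le> M"
      "S \<le> K * (K - 1) + (M - K - 1) * (S - K)" for K M S
    using that by (intro sum_quadratic_le[OF fin y0]) auto
  \<comment> \<open>Side condition of \<open>quad\<close> for degrees up to 3: the claimed bound
    must also cover families with all \<open>y \<le> 2\<close>, where only \<open>S\<close> is
    available.\<close>
  have big: "int n \<le> (int n - 3) * (int n - 4)"
  proof -
    have n8: "8 \<le> int n" using n(2) by simp
    then have "5 * (int n - 4) \<le> (int n - 3) * (int n - 4)" by (intro mult_right_mono) auto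
    moreover have "int n \<le> 5 * (int n - 4)" using n8 by simp
    ultimately show ?thesis by (rule order_trans[rotated])
  qed
  consider "d = 1" | "d = 2" | "d = 3" | "4 \<le> d" using d by linarith
  then show thesis
  proof cases
    case 1
    then obtain u where u: "?N = {u}" by (auto simp: d_def card_1_singleton_iff)
    have S: "(\<Sum>u\<in>?N. y u) \<le> int n - 3" using yn[of u] u by simp
    \<comment> \<open>With one neighbour the pair condition is vacuous; \<open>M = n - 2\<close> is
      chosen so that \<open>M - K - 1\<close> vanishes.\<close>
    have "(\<Sum>u\<in>?N. y u * (y u - 1)) \<le> (int n - 3) * (int n - 3 - 1) + (int n - 2 - (int n - 3) - 1) * (int n - 3 - (int n - 3))"
      using 1 yn S big u by (intro quad) auto
    then show thesis using 1 yn S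
      by (intro main[of "int n - 3" "int n - 3" "(int n - 3) * (int n - 4)"])
        (auto simp: moment_bounds_def d_def)
  next
    case 2
    then obtain u w where u: "?N = {u, w}" "u \<noteq> w" by (auto simp: d_def card_2_iff)
    have S: "(\<Sum>u\<in>?N. y u) \<le> int n" using pair[of u w] u 2 by simp
    have "(\<Sum>u\<in>?N. y u * (y u - 1)) \<le> (int n - 3) * (int n - 3 - 1) + (int n - (int n - 3) - 1) * (int n - (int n - 3))"
      using 2 yn S big pair by (intro quad) auto
    then show thesis using 2 yn S
      by (intro main[of "int n - 3" "int n" "(int n - 3) * (int n - 4) + 6"])
        (auto simp: moment_bounds_def d_def)
  next
    case 3
    have S: "(\<Sum>u\<in>?N. y u) \<le> int n" using total 3 by simp
    have "(\<Sum>u\<in>?N. y u * (y u - 1)) \<le> (int n - 3) * (int n - 3 - 1) + (int n - 1 - (int n - 3) - 1) * (int n - (int n - 3))"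
      using 3 yn S big pair by (intro quad) auto
    then show thesis using 3 yn S
      by (intro main[of "int n - 3" "int n" "(int n - 3) * (int n - 4) + 3"])
        (auto simp: moment_bounds_def d_def)
  next
    case 4
    have le: "int n + 3 - d \<le> (int n + 1 - d) * (int n + 1 - d - 1)"
    proof -
      have "3 * (int n - d) \<le> (int n + 1 - d) * (int n - d)" using d by (intro mult_right_mono) auto
      then show ?thesis using d by (simp add: algebra_simps)
    qed
    have "(\<Sum>u\<in>?N. y u * (y u - 1)) \<le> (int n + 1 - d) * (int n + 1 - d - 1)
        + (int n + 2 - d - (int n + 1 - d) - 1) * (int n + 3 - d - (int n + 1 - d))"
      using 4 yd total pair le by (intro quad) auto
    then show thesis using 4 yd total d
      by (intro main[of "int n + 1 - d" "int n + 3 - d" "(int n + 1 - d) * (int n - d)"])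
        (auto simp: moment_bounds_def d_def)
  qed
qed

text \<open>Here \<open>1 + y\<close> is the degree of a neighbour and \<open>1 + b * y\<close> its
  weight. Evaluating the expansion at y = 0 and y = 1 shows where the coefficients come from:
  \<open>c0 d = f d 1\<close> and \<open>c1 d = (1 + b) * f d 2 - f d 1\<close>.\<close>

lemma rho_le_of_row_bound:
  fixes n :: nat and c0 c1 c2 c3 :: "real \<Rightarrow> real"
  assumes G: "G \<in> bicyclic_graphs n" and n: "8 \<le> n"
    and max: "\<And>u. u < n \<Longrightarrow> card (nbrs G u) \<le> n - 2"
    and f0: "\<And>x y. 0 \<le> x \<Longrightarrow> 0 \<le> y \<Longrightarrow> 0 \<le> f x y" and b: "0 \<le> b"
    and f: "\<And>d y. f d (1 + y) * (1 + b * y)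
      = c0 d + c1 d * y + c2 d * (y * (y - 1)) + c3 d * ((y + 1) * (y * (y - 1)))"
    and c: "\<And>d. 1 \<le> d \<Longrightarrow> 0 \<le> c1 d" "\<And>d. 1 \<le> d \<Longrightarrow> 0 \<le> c2 d" "\<And>d. 1 \<le> d \<Longrightarrow> 0 \<le> c3 d"
    and row: "\<And>d K S P. moment_bounds n d K S P \<Longrightarrow>
      c0 d * d + c1 d * S + (c2 d + c3 d * (K + 1)) * P \<le> \<mu> * (1 + b * (d - 1))"
  shows "rho f G \<le> \<mu>"
proof -
  from G have V: "pverts G = {..<n}" and bi: "bicyclic G" by (auto simp: bicyclic_graphs_def)
  have deg1: "1 \<le> card (nbrs G u)" if "u < n" for u
    using nbrs_nonempty[OF bi, of u] that V n finite_nbrs[OF bi]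
    by (simp add: Suc_le_eq card_gt_0_iff)
  show ?thesis
  proof (rule rho_le_weighted_row_sum[where x = "\<lambda>u. 1 + b * (real (card (nbrs G u)) - 1)"])
    show "nbrs G v \<subseteq> {..<n}" for v using nbrs_subset[OF bi] V by auto
    show "0 < 1 + b * (real (card (nbrs G v)) - 1)" if "v < n" for v
      using deg1[OF that] b by (intro add_pos_nonneg mult_nonneg_nonneg) auto
  next
    fix v assume v: "v < n"
    let ?y = "\<lambda>u. real (card (nbrs G u)) - 1"
    define d where "d = real (card (nbrs G v))"
    have d1: "1 \<le> d" using deg1[OF v] by (simp add: d_def)
    obtain K S P where KSP: "moment_bounds n d K S P"
      "\<And>u. u \<in> nbrs G v \<Longrightarrow> ?y u \<le> K" "(\<Sum>u\<in>nbrs G v. ?y u) \<le> S"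
      "(\<Sum>u\<in>nbrs G v. ?y u * (?y u - 1)) \<le> P"
      unfolding d_def using nbr_moments[OF bi, of n v] V n v max by auto
    have K: "0 \<le> K" using KSP(1) n unfolding moment_bounds_def by auto
    have y0: "0 \<le> ?y u * (?y u - 1)" if "u \<in> nbrs G v" for u
    proof -
      have "u < n" using that nbrs_subset[OF bi] V by auto
      from deg1[OF this] consider "card (nbrs G u) = 1" | "2 \<le> card (nbrs G u)" by linarith
      then show ?thesis by cases auto
    qed
    have "(\<Sum>j\<in>nbrs G v. f (real (degree_of G v)) (real (degree_of G j)) * (1 + b * ?y j))
      \<le> c0 d * card (nbrs G v) + c1 d * S + (c2 d + c3 d * (K + 1)) * P"
    proof (rule row_sum_le_moments[OF _ y0 KSP(2-4) c(1)[OF d1] c(2)[OF d1] c(3)[OF d1] K])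
      fix k
      show "f (real (degree_of G v)) (real (degree_of G k)) * (1 + b * ?y k)
        = c0 d + c1 d * ?y k + c2 d * (?y k * (?y k - 1)) + c3 d * ((?y k + 1) * (?y k * (?y k - 1)))"
        using f[of d "?y k"] unfolding degree_of_eq_card_nbrs d_def by simp
    qed
    also have "\<dots> \<le> \<mu> * (1 + b * (d - 1))" using row[OF KSP(1)] by (simp add: d_def)
    finally show "(\<Sum>j\<in>nbrs G v. f (real (degree_of G v)) (real (degree_of G j)) * (1 + b * ?y j))
      \<le> \<mu> * (1 + b * ?y v)" by (simp add: d_def)
  qed (use V n f0 in auto)
qed

section \<open>Stars with two chords\<close>

text \<open>Chords are two-element sets avoiding the centre, so whether they touch is just whether
  \<open>e \<inter> e'\<close> is empty. Describing arcs through \<open>{u, v}\<close> makes them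
  symmetric, and loops are excluded because every listed edge has two elements.\<close>

definition two_chords :: "nat \<Rightarrow> nat \<Rightarrow> nat set \<Rightarrow> nat set \<Rightarrow> nat pair_pre_digraph \<Rightarrow> bool" where
  "two_chords n c e e' G \<longleftrightarrow> pverts G = {..<n} \<and> c < n \<and> e \<noteq> e' \<and> card e = 2 \<and> card e' = 2 \<and>
    e \<union> e' \<subseteq> {..<n} - {c} \<and>
    parcs G = {(u, v). {u, v} \<in> (\<lambda>k. {c, k}) ` ({..<n} - {c}) \<union> {e, e'}}"

text \<open>The star at \<open>c\<close> uses \<open>n - 1\<close> of the \<open>n + 1\<close>
  edges, so exactly two remain, and an edge outside the star cannot contain
  \<open>c\<close>.\<close>

lemma two_chords_if_dominating:
  assumes G: "G \<in> bicyclic_graphs n" and n: "2 \<le> n" and c: "c < n" and deg: "n - 1 \<le> card (nbrs G c)"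
  obtains e e' where "two_chords n c e e' G"
proof -
  from G have V: "pverts G = {..<n}" and bi: "bicyclic G" by (auto simp: bicyclic_graphs_def)
  let ?star = "(\<lambda>k. {c, k}) ` ({..<n} - {c})"
  have N: "nbrs G c = {..<n} - {c}"
    using nbrs_subset[OF bi, of c] V deg c by (intro card_seteq) (auto simp: card_Diff_singleton)
  have star: "?star \<subseteq> uedges G" using N by (auto simp: uedges_def nbrs_def)
  have cstar: "card ?star = n - 1"
    using c by (subst card_image) (auto simp: inj_on_def doubleton_eq_iff)
  have fin: "finite (uedges G)"
    using finite_parcs(1)[OF bi] by (rule finite_surj[of _ _ "\<lambda>(u, v). {u, v}"]) (auto simp: uedges_def)
  have "card (uedges G - ?star) = 2"
    using bi V cstar star fin n by (subst card_Diff_subset) (auto simp: bicyclic_def)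
  then obtain e e' where e: "uedges G - ?star = {e, e'}" "e \<noteq> e'" by (auto simp: card_2_iff)
  have chord: "card x = 2 \<and> x \<subseteq> {..<n} - {c}" if "x \<in> uedges G - ?star" for x
  proof -
    from that obtain u v where uv: "x = {u, v}" "(u, v) \<in> parcs G" by (auto simp: uedges_def)
    have "u \<noteq> v" "u < n" "v < n" using parcs_irreflexive[OF bi uv(2)] parcs_subset[OF bi uv(2)] V by auto
    moreover have "u \<noteq> c" "v \<noteq> c" using that uv(1) calculation by (auto simp: insert_commute)
    ultimately show ?thesis using uv(1) by auto
  qed
  have "parcs G = {(u, v). {u, v} \<in> uedges G}"
    using parcs_symmetric[OF bi] by (auto simp: uedges_def doubleton_eq_iff)
  moreover have "uedges G = ?star \<union> {e, e'}" using e star by blast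
  ultimately have "parcs G = {(u, v). {u, v} \<in> ?star \<union> {e, e'}}" by (simp only:)
  then show thesis
    using that[of e e'] V c e chord[of e] chord[of e'] unfolding two_chords_def by auto
qed

lemma two_chords_arc:
  assumes "two_chords n c e e' G"
  shows "(u, v) \<in> parcs G \<longleftrightarrow>
    u = c \<and> v < n \<and> v \<noteq> c \<or> v = c \<and> u < n \<and> u \<noteq> c \<or> {u, v} = e \<or> {u, v} = e'"
  using assms unfolding two_chords_def by (auto simp: doubleton_eq_iff)

lemma two_chords_bicyclic:
  assumes G: "two_chords n c e e' G" and n: "2 \<le> n"
  shows "G \<in> bicyclic_graphs n"
proof -
  from G have V: "pverts G = {..<n}" and c: "c < n" and e: "e \<noteq> e'" "card e = 2" "card e' = 2"
    "e \<subseteq> {..<n} - {c}" "e' \<subseteq> {..<n} - {c}" by (auto simp: two_chords_def)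
  note arc = two_chords_arc[OF G]
  let ?star = "(\<lambda>k. {c, k}) ` ({..<n} - {c})"
  have V2: "u < n \<and> v < n \<and> u \<noteq> v" if "(u, v) \<in> parcs G" for u v
    using that e c unfolding arc by auto
  have sym: "(v, u) \<in> parcs G" if "(u, v) \<in> parcs G" for u v
    using that unfolding arc by (auto simp: insert_commute)
  have fin: "finite (parcs G)" by (rule finite_subset[of _ "{..<n} \<times> {..<n}"]) (auto dest: V2)
  have pg: "pair_graph G"
    by unfold_locales (auto simp: V fin symmetric_def sym_def dest: V2 intro: sym)
  have "uedges G = ?star \<union> {e, e'}"
  proof
    show "uedges G \<subseteq> ?star \<union> {e, e'}" unfolding uedges_def arc by (auto simp: insert_commute)
    have "x \<in> uedges G" if "x = e \<or> x = e'" for x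
    proof -
      from that e have "card x = 2" by auto
      then obtain u v where "x = {u, v}" by (auto simp: card_2_iff)
      then show ?thesis unfolding uedges_def arc using that by blast
    qed
    then show "?star \<union> {e, e'} \<subseteq> uedges G" unfolding uedges_def arc by blast
  qed
  moreover have "card ?star = n - 1"
    using c by (subst card_image) (auto simp: inj_on_def doubleton_eq_iff)
  moreover have "?star \<inter> {e, e'} = {}" using e by auto
  ultimately have "card (uedges G) = n + 1" using e n by (simp add: card_Un_disjoint)
  moreover have "connected (with_proj G)"
  proof -
    let ?H = "mk_symmetric (with_proj G)"
    have H: "parcs ?H = parcs G" using sym by (auto simp: parcs_mk_symmetric)
    interpret H: pair_wf_digraph ?H
      by unfold_locales (auto simp: H V dest: V2)
    have star: "u \<rightarrow>\<^sup>*\<^bsub>with_proj ?H\<^esub> c \<and> c \<rightarrow>\<^sup>*\<^bsub>with_proj ?H\<^esub> u" if u: "u < n" for u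
    proof (cases "u = c")
      case True
      then show ?thesis using H.reachable_refl[of c] c V by simp
    next
      case False
      then have "(u, c) \<in> parcs ?H" "(c, u) \<in> parcs ?H" using u c unfolding H arc by auto
      then show ?thesis using H.reachable_adjI by blast
    qed
    show ?thesis unfolding connected_def
    proof (rule strongly_connectedI)
      show "verts (with_proj ?H) \<noteq> {}" using V c by auto
      fix u v assume "u \<in> verts (with_proj ?H)" "v \<in> verts (with_proj ?H)"
      then have "u < n" "v < n" using V by auto
      then show "u \<rightarrow>\<^sup>*\<^bsub>with_proj ?H\<^esub> v" using star H.reachable_trans by blast
    qed
  qed
  ultimately show ?thesis using V pg by (simp add: bicyclic_graphs_def bicyclic_def)
qed

lemma two_chords_nbrs:
  assumes G: "two_chords n c e e' G"
  shows "nbrs G c = {..<n} - {c}"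
    and "v < n \<Longrightarrow> v \<noteq> c \<Longrightarrow> nbrs G v
      = insert c ((if v \<in> e then e - {v} else {}) \<union> (if v \<in> e' then e' - {v} else {}))"
proof -
  from G have e: "card e = 2" "card e' = 2" "e \<subseteq> {..<n} - {c}" "e' \<subseteq> {..<n} - {c}"
    by (auto simp: two_chords_def)
  note arc = two_chords_arc[OF G]
  have not: "{c, w} \<noteq> e \<and> {c, w} \<noteq> e'" for w using e by auto
  then show "nbrs G c = {..<n} - {c}" by (auto simp: nbrs_def arc)
  assume v: "v < n" "v \<noteq> c"
  have pair: "{v, w} = x \<longleftrightarrow> v \<in> x \<and> w \<in> x - {v}" if "card x = 2" for x w
    using that by (auto simp: card_2_iff)
  show "nbrs G v = insert c ((if v \<in> e then e - {v} else {}) \<union> (if v \<in> e' then e' - {v} else {}))"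
    using v e(3,4) unfolding nbrs_def arc pair[OF e(1)] pair[OF e(2)] by auto
qed

lemma two_chords_sets:
  assumes G: "two_chords n c e e' G"
  shows "pverts G = {..<n}" "c < n" "\<And>v. v < n \<Longrightarrow> nbrs G v \<subseteq> {..<n}"
    "c \<notin> e" "c \<notin> e'" "e \<subseteq> {..<n}" "e' \<subseteq> {..<n}" "card (nbrs G c) = n - 1"
proof -
  show A: "pverts G = {..<n}" "c < n" "c \<notin> e" "c \<notin> e'" "e \<subseteq> {..<n}" "e' \<subseteq> {..<n}"
    using G by (auto simp: two_chords_def)
  show "card (nbrs G c) = n - 1" using two_chords_nbrs(1)[OF G] A(2) by simp
  show "nbrs G v \<subseteq> {..<n}" if "v < n" for v
    using two_chords_nbrs[OF G] that A by (cases "v = c") auto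
qed

section \<open>Positive eigenvectors of the stars with two chords\<close>

lemma rho_disjoint_chords:
  fixes f :: "real \<Rightarrow> real \<Rightarrow> real" and n :: nat
  assumes G: "two_chords n c e e' G" and disj: "e \<inter> e' = {}" and n: "5 \<le> n"
    and f0: "\<And>x y. 0 \<le> x \<Longrightarrow> 0 \<le> y \<Longrightarrow> 0 \<le> f x y" and fc: "\<And>x y. f x y = f y x"
    and pos: "0 < x" "0 < y"
    and x: "\<mu> * x = f (real n - 1) 2 + f 2 2 * x" and y: "\<mu> * y = f (real n - 1) 1"
    and \<mu>: "\<mu> = (real n - 5) * (f (real n - 1) 1 * y) + 4 * (f (real n - 1) 2 * x)"
  shows "rho f G = \<mu>"
proof -
  note S = two_chords_sets[OF G]
  from G have c2: "card e = 2" "card e' = 2" by (auto simp: two_chords_def)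
  have fin: "finite e" "finite e'" using c2 card.infinite by fastforce+
  have nb1: "nbrs G v = {c}" if "v < n" "v \<noteq> c" "v \<notin> e \<union> e'" for v
    using two_chords_nbrs(2)[OF G that(1,2)] that(3) by simp
  have nb2: "\<exists>w. nbrs G v = {c, w} \<and> w \<in> e \<union> e'" if v: "v \<in> e \<union> e'" for v
  proof -
    have vn: "v < n" "v \<noteq> c" using v S by auto
    define z where "z = (if v \<in> e then e else e')"
    have z: "card z = 2" "v \<in> z" "z \<subseteq> e \<union> e'" using v c2 by (auto simp: z_def)
    have "nbrs G v = insert c (z - {v})"
    proof (cases "v \<in> e")
      case True
      then have "v \<notin> e'" using disj by blast
      with True show ?thesis using two_chords_nbrs(2)[OF G vn] by (simp add: z_def)
    next
      case False
      then have "v \<in> e'" using v by blast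
      with False show ?thesis using two_chords_nbrs(2)[OF G vn] by (simp add: z_def)
    qed
    moreover have "card (z - {v}) = 1" using z by simp
    then obtain w where w: "z - {v} = {w}" by (auto simp: card_1_singleton_iff)
    moreover have "w \<in> e \<union> e'" using w z(3) by blast
    ultimately show ?thesis by blast
  qed
  have d2: "real (degree_of G v) = 2" if "v \<in> e \<union> e'" for v
  proof -
    from nb2[OF that] obtain w where w: "nbrs G v = {c, w}" "w \<in> e \<union> e'" by blast
    moreover have "w \<noteq> c" using w(2) S(4,5) by blast
    ultimately show ?thesis by (simp add: degree_of_eq_card_nbrs)
  qed
  have d1: "real (degree_of G v) = 1" if "v < n" "v \<noteq> c" "v \<notin> e \<union> e'" for v
    using nb1[OF that] by (simp add: degree_of_eq_card_nbrs)
  have dc: "real (degree_of G c) = real n - 1" using S(8) n by (simp add: degree_of_eq_card_nbrs)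
  \<comment> \<open>The centre is normalised to 1. The hypotheses on \<open>x\<close>,
    \<open>y\<close> and \<open>\<mu>\<close> are the eigenvalue equations at a chord end, at a
    pendant vertex and at the centre.\<close>
  let ?x = "\<lambda>v. if v = c then 1 else if v \<in> e \<union> e' then x else y"
  show ?thesis
  proof (rule rho_eq_positive_eigenvector[where x = ?x and n = n])
    fix v assume v: "v < n"
    consider "v = c" | "v \<noteq> c" "v \<in> e \<union> e'" | "v \<noteq> c" "v \<notin> e \<union> e'" by blast
    then show "(\<Sum>j\<in>nbrs G v. f (real (degree_of G v)) (real (degree_of G j)) * ?x j) = \<mu> * ?x v"
    proof cases
      case 1
      let ?R = "{..<n} - insert c (e \<union> e')"
      let ?t = "\<lambda>j. f (real (degree_of G v)) (real (degree_of G j)) * ?x j"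
      have part: "nbrs G v = ?R \<union> (e \<union> e')" using two_chords_nbrs(1)[OF G] 1 S by auto
      have card4: "card (e \<union> e') = 4" using fin disj c2 by (simp add: card_Un_disjoint)
      have cardR: "card ?R = n - 5"
        using fin S card4 by (subst card_Diff_subset) auto
      have "sum ?t (nbrs G v) = sum ?t ?R + sum ?t (e \<union> e')"
        unfolding part using fin by (intro sum.union_disjoint) auto
      also have "sum ?t ?R = (\<Sum>j\<in>?R. f (real n - 1) 1 * y)"
      proof (rule sum.cong[OF refl])
        fix j assume "j \<in> ?R"
        then have "j < n" "j \<noteq> c" "j \<notin> e \<union> e'" by auto
        then show "?t j = f (real n - 1) 1 * y" using 1 d1[of j] dc by simp
      qed
      also have "sum ?t (e \<union> e') = (\<Sum>j\<in>e \<union> e'. f (real n - 1) 2 * x)"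
      proof (rule sum.cong[OF refl])
        fix j assume j: "j \<in> e \<union> e'"
        then have "j \<noteq> c" using S(4,5) by blast
        then show "?t j = f (real n - 1) 2 * x" using 1 j d2[OF j] dc by simp
      qed
      finally show ?thesis using \<mu> 1 card4 cardR n by (simp add: of_nat_diff)
    next
      case 2
      from nb2[OF 2(2)] obtain w where w: "nbrs G v = {c, w}" "w \<in> e \<union> e'" by blast
      have "w \<noteq> c" using w(2) S(4,5) by blast
      then show ?thesis using 2 w d2[OF 2(2)] d2[OF w(2)] dc x
        by (simp add: fc[of 2 "real n - 1"])
    next
      case 3
      then show ?thesis using nb1[OF v 3] d1[OF v 3] dc y by (simp add: fc[of 1 "real n - 1"])
    qed
  qed (use S n f0 pos in auto)
qed

lemma rho_adjacent_chords:
  fixes f :: "real \<Rightarrow> real \<Rightarrow> real" and n :: nat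
  assumes G: "two_chords n c {a, b} {a, d} G" and n: "5 \<le> n"
    and f0: "\<And>x y. 0 \<le> x \<Longrightarrow> 0 \<le> y \<Longrightarrow> 0 \<le> f x y" and fc: "\<And>x y. f x y = f y x"
    and pos: "0 < x" "0 < y" "0 < z"
    and x: "\<mu> * x = f (real n - 1) 3 + 2 * (f 2 3 * y)" and y: "\<mu> * y = f (real n - 1) 2 + f 2 3 * x"
    and z: "\<mu> * z = f (real n - 1) 1"
    and \<mu>: "\<mu> = (real n - 4) * (f (real n - 1) 1 * z) + f (real n - 1) 3 * x + 2 * (f (real n - 1) 2 * y)"
  shows "rho f G = \<mu>"
proof -
  note S = two_chords_sets[OF G]
  have ne: "a \<noteq> b" "a \<noteq> d" "b \<noteq> d" using G by (auto simp: two_chords_def card_2_iff doubleton_eq_iff)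
  have nec: "a \<noteq> c" "b \<noteq> c" "d \<noteq> c" and lt: "a < n" "b < n" "d < n" using S by auto
  have nba: "nbrs G a = {c, b, d}" and nbb: "nbrs G b = {c, a}" and nbd: "nbrs G d = {c, a}"
    using two_chords_nbrs(2)[OF G] ne nec lt by auto
  have nb1: "nbrs G v = {c}" if "v < n" "v \<noteq> c" "v \<noteq> a" "v \<noteq> b" "v \<noteq> d" for v
    using two_chords_nbrs(2)[OF G] that by simp
  have da: "real (degree_of G a) = 3" and db: "real (degree_of G b) = 2"
    and dd: "real (degree_of G d) = 2" and dc: "real (degree_of G c) = real n - 1"
    using ne nec S(8) n by (auto simp: degree_of_eq_card_nbrs nba nbb nbd)
  have d1: "real (degree_of G v) = 1" if "v < n" "v \<noteq> c" "v \<noteq> a" "v \<noteq> b" "v \<noteq> d" for v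
    using nb1[OF that] by (simp add: degree_of_eq_card_nbrs)
  \<comment> \<open>Four classes now: the common chord end \<open>a\<close> of degree 3 gets
    \<open>x\<close>, the other ends \<open>b\<close> and \<open>d\<close> get \<open>y\<close>, and
    pendant vertices get \<open>z\<close>.\<close>
  let ?x = "\<lambda>v. if v = c then 1 else if v = a then x else if v = b \<or> v = d then y else z"
  show ?thesis
  proof (rule rho_eq_positive_eigenvector[where x = ?x and n = n])
    fix v assume v: "v < n"
    consider "v = c" | "v = a" | "v = b" | "v = d" | "v \<noteq> c" "v \<noteq> a" "v \<noteq> b" "v \<noteq> d" by blast
    then show "(\<Sum>j\<in>nbrs G v. f (real (degree_of G v)) (real (degree_of G j)) * ?x j) = \<mu> * ?x v"
    proof cases
      case 1
      let ?R = "{..<n} - {c, a, b, d}"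
      let ?t = "\<lambda>j. f (real (degree_of G v)) (real (degree_of G j)) * ?x j"
      have part: "nbrs G v = ?R \<union> {a, b, d}" using two_chords_nbrs(1)[OF G] 1 nec lt by auto
      have cardR: "card ?R = n - 4"
        using ne nec lt S(2) by (subst card_Diff_subset) auto
      have "sum ?t (nbrs G v) = sum ?t ?R + sum ?t {a, b, d}"
        unfolding part by (intro sum.union_disjoint) auto
      also have "sum ?t ?R = (\<Sum>j\<in>?R. f (real n - 1) 1 * z)"
        using 1 d1 dc by (intro sum.cong) auto
      also have "sum ?t {a, b, d} = f (real n - 1) 3 * x + 2 * (f (real n - 1) 2 * y)"
        using 1 dc ne nec by (simp add: da db dd)
      finally show ?thesis using \<mu> 1 cardR n by (simp add: of_nat_diff)
    next
      case 2
      have "nbrs G v = {c, b, d}" using 2 nba by simp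
      then show ?thesis using 2 ne nec x
        by (simp add: da db dd dc fc[of 3 2] fc[of 3 "real n - 1"])
    next
      case 3
      have "nbrs G v = {c, a}" using 3 nbb by simp
      then show ?thesis using 3 ne nec y by (simp add: da db dc fc[of 2 "real n - 1"])
    next
      case 4
      have "nbrs G v = {c, a}" using 4 nbd by simp
      then show ?thesis using 4 ne nec y by (simp add: da dd dc fc[of 2 "real n - 1"])
    next
      case 5
      then show ?thesis using nb1[OF v 5] d1[OF v 5] dc z by (simp add: fc[of 1 "real n - 1"])
    qed
  qed (use S n f0 pos in auto)
qed

text \<open>Adjacency is determined by the centre and the two chords, so a permutation carrying
  these over preserves arcs; on arcs it acts as \<open>map_prod \<pi> \<pi>\<close>.\<close>

lemma two_chords_iso:
  assumes G: "two_chords n c e e' G" and H: "two_chords n c' x x' H"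
    and n: "2 \<le> n"
    and \<pi>: "bij_betw \<pi> {..<n} {..<n}" "\<pi> c = c'" "\<pi> ` e = x" "\<pi> ` e' = x'"
  shows "digraph_iso (with_proj G) (with_proj H)"
proof -
  note S = two_chords_sets[OF G] and S' = two_chords_sets[OF H]
  have bi: "bicyclic G" "bicyclic H"
    using two_chords_bicyclic[OF G n] two_chords_bicyclic[OF H n] by (auto simp: bicyclic_graphs_def)
  have inj: "\<pi> u = \<pi> v \<longleftrightarrow> u = v" if "u < n" "v < n" for u v
    using \<pi>(1) that by (auto simp: bij_betw_def inj_on_eq_iff)
  have less: "\<pi> u < n" if "u < n" for u using \<pi>(1) that by (auto simp: bij_betw_def)
  have chord: "{\<pi> u, \<pi> v} = \<pi> ` z \<longleftrightarrow> {u, v} = z" if "u < n" "v < n" "z \<subseteq> {..<n}" for u v z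
    using inj_on_image_eq_iff[of \<pi> "{..<n}" "{u, v}" z] \<pi>(1) that by (auto simp: bij_betw_def)
  have arc: "(\<pi> u, \<pi> v) \<in> parcs H \<longleftrightarrow> (u, v) \<in> parcs G" if "u < n" "v < n" for u v
    unfolding two_chords_arc[OF G] two_chords_arc[OF H] \<pi>(2)[symmetric] \<pi>(3)[symmetric] \<pi>(4)[symmetric]
    using that S by (simp add: inj less chord)
  have arcs: "parcs H = map_prod \<pi> \<pi> ` parcs G"
  proof (intro equalityI subsetI)
    fix p assume p: "p \<in> parcs H"
    obtain u' v' where p': "p = (u', v')" by (cases p)
    then have "u' \<in> \<pi> ` {..<n}" "v' \<in> \<pi> ` {..<n}"
      using parcs_subset[OF bi(2)] p S' \<pi>(1) by (auto simp: bij_betw_def)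
    then obtain u v where "u' = \<pi> u" "v' = \<pi> v" "u < n" "v < n" by auto
    with p p' arc[of u v] show "p \<in> map_prod \<pi> \<pi> ` parcs G" by force
  next
    fix p assume "p \<in> map_prod \<pi> \<pi> ` parcs G"
    then obtain u v where "(u, v) \<in> parcs G" "p = (\<pi> u, \<pi> v)" by auto
    with arc[of u v] parcs_subset[OF bi(1), of u v] S show "p \<in> parcs H" by auto
  qed
  let ?hom = "\<lparr>iso_verts = \<pi>, iso_arcs = map_prod \<pi> \<pi>, iso_head = snd, iso_tail = fst\<rparr>"
  have inj_\<pi>: "inj_on \<pi> {..<n}" using \<pi>(1) by (simp add: bij_betw_def)
  have "parcs G \<subseteq> {..<n} \<times> {..<n}" using parcs_subset[OF bi(1)] S by auto
  then have "inj_on (map_prod \<pi> \<pi>) (parcs G)"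
    using map_prod_inj_on[OF inj_\<pi> inj_\<pi>] by (rule inj_on_subset[rotated])
  moreover have "wf_digraph (with_proj G)"
    using parcs_subset[OF bi(1)] by unfold_locales auto
  ultimately have "pre_digraph.digraph_isomorphism (with_proj G) ?hom"
    using S inj_\<pi> by (auto simp: pre_digraph.digraph_isomorphism_def)
  moreover have "with_proj H = app_iso ?hom (with_proj G)"
    using S' S \<pi>(1) arcs by (simp add: app_iso_def with_proj_def bij_betw_def)
  ultimately show ?thesis unfolding digraph_iso_def by blast
qed

lemma fixed_point_above:
  fixes g :: "real \<Rightarrow> real"
  assumes cont: "continuous_on {m..} g" and decr: "\<And>x. m \<le> x \<Longrightarrow> g x \<le> g m" and m: "m < g m"
  obtains x where "m < x" "g x = x"
proof -
  \<comment> \<open>The right end \<open>g m\<close> works because \<open>decr\<close> gives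
    \<open>g (g m) \<le> g m\<close>, hence a sign change of \<open>g x - x\<close> on this
    interval.\<close>
  have "continuous_on {m..g m} (\<lambda>x. g x - x)"
    by (intro continuous_intros continuous_on_subset[OF cont]) auto
  then obtain x where x: "m \<le> x" "g x - x = 0"
    using IVT2'[of "\<lambda>x. g x - x" "g m" 0 m] m decr[of "g m"] by auto
  have "x \<noteq> m" using x m by auto
  with x have "m < x" "g x = x" by auto
  then show thesis by (rule that)
qed

lemma G2_two_chords:
  assumes n: "5 \<le> n"
  shows "two_chords n 0 {1, 2} {3, 4} (G2 n)"
proof -
  define E :: "nat rel" where "E = (\<lambda>k. (0, k)) ` {1..<n} \<union> {(1, 2), (3, 4)}"
  have "{1..<n} = {1, 2, 3, 4} \<union> {k. 5 \<le> k \<and> k < n}" using n by auto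
  then have "E = {(0, 1), (0, 2), (1, 2)} \<union> {(0, 3), (0, 4), (3, 4)} \<union> {(0, k) | k. 5 \<le> k \<and> k < n}"
    unfolding E_def by blast
  then have arcs: "parcs (G2 n) = E \<union> E\<inverse>" unfolding G2_def Let_def by (simp only: pair_pre_digraph.simps)
  have arc: "(u, v) \<in> parcs (G2 n) \<longleftrightarrow>
      {u, v} \<in> (\<lambda>k. {0, k}) ` ({..<n} - {0}) \<union> {{1, 2}, {3, 4}}" for u v
  proof -
    have "(u, v) \<in> E \<union> E\<inverse> \<longleftrightarrow> u = 0 \<and> v \<in> {1..<n} \<or> v = 0 \<and> u \<in> {1..<n} \<or>
        {u, v} = {1, 2} \<or> {u, v} = {3, 4}"
      unfolding E_def doubleton_eq_iff by blast
    also have "{1..<n} = {..<n} - {0}" by auto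
    finally have mem: "(u, v) \<in> E \<union> E\<inverse> \<longleftrightarrow> u = 0 \<and> v \<in> {..<n} - {0} \<or> v = 0 \<and> u \<in> {..<n} - {0} \<or>
        {u, v} = {1, 2} \<or> {u, v} = {3, 4}" .
    have star: "{u, v} \<in> (\<lambda>k. {0, k}) ` X \<longleftrightarrow> u = 0 \<and> v \<in> X \<or> v = 0 \<and> u \<in> X" for X
      unfolding image_iff doubleton_eq_iff by blast
    show ?thesis unfolding arcs mem by (simp only: Un_iff star insert_iff empty_iff simp_thms disj_assoc)
  qed
  have P: "parcs (G2 n) = {(u, v). {u, v} \<in> (\<lambda>k. {0, k}) ` ({..<n} - {0}) \<union> {{1, 2}, {3, 4}}}"
    by (intro equalityI subrelI) (simp_all only: arc mem_Collect_eq case_prod_conv)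
  have V: "pverts (G2 n) = {..<n}" by (simp add: G2_def)
  show ?thesis unfolding two_chords_def P V
    using n by (intro conjI refl) (auto simp: doubleton_eq_iff)
qed

lemma disjoint_chords_iso_G2:
  assumes G: "two_chords n c e e' G" and disj: "e \<inter> e' = {}" and n: "5 \<le> n"
  shows "digraph_iso (with_proj G) (with_proj (G2 n))"
proof -
  note S = two_chords_sets[OF G]
  obtain a1 a2 a3 a4 where e: "e = {a1, a2}" "e' = {a3, a4}" "a1 \<noteq> a2" "a3 \<noteq> a4"
    using G by (auto simp: two_chords_def card_2_iff)
  let ?A = "{c, a1, a2, a3, a4}"
  have ne: "c \<noteq> a1" "c \<noteq> a2" "c \<noteq> a3" "c \<noteq> a4" "a1 \<noteq> a3" "a1 \<noteq> a4" "a2 \<noteq> a3" "a2 \<noteq> a4"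
    using S disj e by auto
  have A: "?A \<subseteq> {..<n}" "card ?A = 5" using S e ne by auto
  have "card ({..<n} - ?A) = card ({..<n} - {0, 1, 2, 3, 4})"
    using A n by (simp only: card_Diff_subset finite.intros) (subst card_Diff_subset, auto)
  then obtain h where h: "bij_betw h ({..<n} - ?A) ({..<n} - {0, 1, 2, 3, 4})"
    using finite_same_card_bij[of "{..<n} - ?A" "{..<n} - {0, 1, 2, 3, 4}"] by auto
  define \<pi> where "\<pi> v = (if v = c then 0 else if v = a1 then 1 else if v = a2 then 2
    else if v = a3 then 3 else if v = a4 then 4 else h v)" for v
  have "bij_betw \<pi> ({..<n} - ?A) ({..<n} - {0, 1, 2, 3, 4})"
    using h by (subst bij_betw_cong[of _ _ h]) (auto simp: \<pi>_def)
  moreover have "bij_betw \<pi> ?A {0, 1, 2, 3, 4}"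
    using ne e(3,4) by (auto simp: \<pi>_def bij_betw_def inj_on_def)
  ultimately have "bij_betw \<pi> (({..<n} - ?A) \<union> ?A) (({..<n} - {0, 1, 2, 3, 4}) \<union> {0, 1, 2, 3, 4})"
    by (rule bij_betw_combine) auto
  moreover have "({..<n} - ?A) \<union> ?A = {..<n}" "({..<n} - {0, 1, 2, 3, 4}) \<union> {0, 1, 2, 3, 4} = {..<n}"
    using A n by auto
  ultimately have "bij_betw \<pi> {..<n} {..<n}" by (simp only:)
  moreover have "\<pi> c = 0" "\<pi> ` e = {1, 2}" "\<pi> ` e' = {3, 4}" using ne e by (auto simp: \<pi>_def)
  ultimately show ?thesis
    using two_chords_iso[OF G G2_two_chords[OF n]] n by auto
qed

text \<open>Since \<open>(\<mu> + w) * (\<mu> - w) \<le> \<mu>\<^sup>2\<close>, the fraction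
  \<open>1 / (\<mu> - w)\<close> is at least \<open>(\<mu> + w) / \<mu>\<^sup>2\<close>. So a
  polynomial inequality in \<open>\<mu>\<close> suffices to place it below the fixed point.\<close>

lemma secular_gt:
  fixes \<mu> :: real
  assumes "0 \<le> w" "w < \<mu>" and gt: "\<mu> ^ 3 < a * \<mu> + c * (\<mu> + w)" and "0 \<le> c"
  shows "\<mu> < a / \<mu> + c / (\<mu> - w)"
proof -
  have \<mu>: "0 < \<mu>" using assms by simp
  have "\<mu> = \<mu> ^ 3 / \<mu>\<^sup>2" using \<mu> by (simp add: field_simps power_numeral_reduce)
  also have "\<dots> < (a * \<mu> + c * (\<mu> + w)) / \<mu>\<^sup>2" using gt \<mu> by (intro divide_strict_right_mono) auto
  also have "\<dots> = a / \<mu> + c * ((\<mu> + w) / \<mu>\<^sup>2)"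
    using \<mu> by (simp add: field_simps power2_eq_square)
  also have "(\<mu> + w) / \<mu>\<^sup>2 \<le> 1 / (\<mu> - w)"
  proof -
    have "(\<mu> + w) * (\<mu> - w) \<le> \<mu>\<^sup>2" by (simp add: algebra_simps power2_eq_square)
    then have "(\<mu> + w) / \<mu>\<^sup>2 * (\<mu> - w) \<le> 1" using \<mu> by simp
    then show ?thesis using assms(2) by (simp add: pos_le_divide_eq)
  qed
  finally show ?thesis using \<open>0 \<le> c\<close> by (simp add: mult_left_mono)
qed

lemma frac_antimono:
  fixes a m x :: real
  assumes "0 \<le> a" "0 < m" "a < m\<^sup>2" "m \<le> x"
  shows "x / (x\<^sup>2 - a) \<le> m / (m\<^sup>2 - a)"
proof -
  have "m\<^sup>2 \<le> x\<^sup>2" using assms by (intro power_mono) auto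
  then have pos: "0 < m\<^sup>2 - a" "0 < x\<^sup>2 - a" using assms(3) by linarith+
  have "0 \<le> (x - m) * (m * x + a)" using assms by (intro mult_nonneg_nonneg) auto
  then have "x * (m\<^sup>2 - a) \<le> m * (x\<^sup>2 - a)" by (simp add: algebra_simps power2_eq_square)
  then show ?thesis using pos by (simp add: frac_le_eq divide_le_0_iff)
qed

section \<open>The second largest value\<close>

text \<open>The weights of edges from the centre to vertices of degree 1, 2, 3 are \<open>p\<close>,
  \<open>q\<close>, \<open>r\<close>; a chord weighs \<open>w\<close> if the chords are disjoint and
  \<open>s\<close> if they meet. The hypothesis \<open>sec\<close> places \<open>\<mu>\<close> below
  the radius for disjoint chords; \<open>qr\<close> and the remaining conditions on
  \<open>\<mu>\<close> place that radius below the one for adjacent chords.\<close>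

lemma second_largest_if_low_degree_bound:
  fixes f :: "real \<Rightarrow> real \<Rightarrow> real" and n :: nat and \<mu> p q r s w :: real
  defines "p \<equiv> f (real n - 1) 1" and "q \<equiv> f (real n - 1) 2" and "r \<equiv> f (real n - 1) 3"
    and "s \<equiv> f 2 3" and "w \<equiv> f 2 2"
  assumes n: "8 \<le> n" and f0: "\<And>x y. 0 \<le> x \<Longrightarrow> 0 \<le> y \<Longrightarrow> 0 \<le> f x y" and fc: "\<And>x y. f x y = f y x"
    and pos: "0 < p" "0 < q" "0 < s"
    and qr: "q \<le> r" "2 * q\<^sup>2 \<le> p\<^sup>2 + r\<^sup>2"
    and \<mu>: "w < \<mu>" "2 * s\<^sup>2 < \<mu>\<^sup>2" "s * w \<le> \<mu> * (s - w)" "w \<le> s"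
    and sec: "\<mu> < (real n - 5) * p\<^sup>2 / \<mu> + 4 * q\<^sup>2 / (\<mu> - w)"
    and low: "\<And>G. G \<in> bicyclic_graphs n \<Longrightarrow> (\<And>u. u < n \<Longrightarrow> card (nbrs G u) \<le> n - 2) \<Longrightarrow> rho f G \<le> \<mu>"
  shows "attains_second_largest (rho f) (bicyclic_graphs n) (G2 n) \<and>
         (\<forall>G. attains_second_largest (rho f) (bicyclic_graphs n) G \<longrightarrow>
              digraph_iso (with_proj G) (with_proj (G2 n)))"
proof -
  have w0: "0 \<le> w" using f0 by (simp add: w_def)
  have \<mu>0: "0 < \<mu>" using w0 \<mu>(1) by simp
  have r0: "0 < r" using pos qr by simp
  \<comment> \<open>\<open>l\<close> and \<open>k\<close> are the spectral radii of the stars with disjoint and with adjacent chords;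
    \<open>g2\<close> and \<open>g1\<close> arise by eliminating all vertices but the centre from the eigenvalue equation.\<close>
  define g2 where "g2 x = (real n - 5) * p\<^sup>2 / x + 4 * q\<^sup>2 / (x - w)" for x
  obtain l where l: "\<mu> < l" "g2 l = l"
  proof (rule fixed_point_above[of \<mu> g2])
    show "continuous_on {\<mu>..} g2" unfolding g2_def using \<mu> \<mu>0 by (intro continuous_intros) auto
    show "g2 x \<le> g2 \<mu>" if "\<mu> \<le> x" for x
      unfolding g2_def using that \<mu> \<mu>0 n by (intro add_mono divide_left_mono mult_pos_pos) auto
    show "\<mu> < g2 \<mu>" using sec by (simp add: g2_def)
  qed
  have l0: "0 < l" "w < l" using l(1) \<mu>0 \<mu>(1) by auto
  have l2: "2 * s\<^sup>2 < l\<^sup>2"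
  proof -
    have "\<mu>\<^sup>2 \<le> l\<^sup>2" using l(1) \<mu>0 by (intro power_mono) auto
    with \<mu>(2) show ?thesis by linarith
  qed
  define g1 where "g1 x = (real n - 4) * p\<^sup>2 / x + (r\<^sup>2 + 2 * q\<^sup>2) * (x / (x\<^sup>2 - 2 * s\<^sup>2))
    + 4 * q * r * s / (x\<^sup>2 - 2 * s\<^sup>2)" for x
  have sq: "2 * s\<^sup>2 < x\<^sup>2" if "l \<le> x" for x
  proof -
    have "l\<^sup>2 \<le> x\<^sup>2" using that l0 by (intro power_mono) auto
    with l2 show ?thesis by linarith
  qed
  obtain k where k: "l < k" "g1 k = k"
  proof (rule fixed_point_above[of l g1])
    show "continuous_on {l..} g1" unfolding g1_def using l0 sq
      by (intro continuous_intros) (auto dest!: sq)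
    show "g1 x \<le> g1 l" if x: "l \<le> x" for x
    proof -
      have "(real n - 4) * p\<^sup>2 / x \<le> (real n - 4) * p\<^sup>2 / l"
        using x l0 n by (intro divide_left_mono mult_pos_pos) auto
      moreover have "x / (x\<^sup>2 - 2 * s\<^sup>2) \<le> l / (l\<^sup>2 - 2 * s\<^sup>2)"
        using l2 l0 x by (intro frac_antimono) auto
      then have "(r\<^sup>2 + 2 * q\<^sup>2) * (x / (x\<^sup>2 - 2 * s\<^sup>2)) \<le> (r\<^sup>2 + 2 * q\<^sup>2) * (l / (l\<^sup>2 - 2 * s\<^sup>2))"
        by (intro mult_left_mono) auto
      moreover have "4 * q * r * s / (x\<^sup>2 - 2 * s\<^sup>2) \<le> 4 * q * r * s / (l\<^sup>2 - 2 * s\<^sup>2)"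
        using l2 sq[OF x] x l0 pos r0 power_mono[of l x 2] by (intro divide_left_mono mult_pos_pos) auto
      ultimately show ?thesis unfolding g1_def by linarith
    qed
    \<comment> \<open>Split the left side into \<open>4 * q\<^sup>2 / l\<close> and an excess. The
      former is absorbed by \<open>p\<close> and \<open>r\<close> through \<open>qr(2)\<close>, the
      excess by \<open>4 * q * r * s / l\<^sup>2\<close> through
      \<open>w * l \<le> s * (l - w)\<close> and \<open>q \<le> r\<close>. Shrinking the denominator
      \<open>l\<^sup>2\<close> by \<open>2 * s\<^sup>2\<close> makes the inequality strict.\<close>
    have "4 * q\<^sup>2 / (l - w) < p\<^sup>2 / l + (r\<^sup>2 + 2 * q\<^sup>2) * (l / (l\<^sup>2 - 2 * s\<^sup>2))
      + 4 * q * r * s / (l\<^sup>2 - 2 * s\<^sup>2)"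
    proof -
      have "1 / l = l / l\<^sup>2" using l0 by (simp add: power2_eq_square)
      also have "\<dots> < l / (l\<^sup>2 - 2 * s\<^sup>2)"
        using l0 l2 pos by (intro divide_strict_left_mono mult_pos_pos) auto
      finally have A: "(r\<^sup>2 + 2 * q\<^sup>2) * (1 / l) < (r\<^sup>2 + 2 * q\<^sup>2) * (l / (l\<^sup>2 - 2 * s\<^sup>2))"
        using pos r0 by (intro mult_strict_left_mono add_pos_pos) auto
      have B: "4 * q * r * s / l\<^sup>2 \<le> 4 * q * r * s / (l\<^sup>2 - 2 * s\<^sup>2)"
        using l2 l0 pos r0 by (intro divide_left_mono mult_pos_pos) auto
      have "\<mu> * (s - w) \<le> l * (s - w)" using \<mu>(4) l(1) by (intro mult_right_mono) auto
      then have "w * l \<le> s * (l - w)" using \<mu>(3) by (simp add: algebra_simps)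
      then have "q * (w * l) \<le> r * (s * (l - w))"
        by (rule mult_mono[OF qr(1)]) (use w0 l0 r0 in auto)
      then have "4 * q * (q * (w * l)) \<le> 4 * q * (r * (s * (l - w)))"
        using pos by (intro mult_left_mono) auto
      then have "4 * q * q * w * l / (l\<^sup>2 * (l - w)) \<le> 4 * q * r * s * (l - w) / (l\<^sup>2 * (l - w))"
        using l0 by (intro divide_right_mono) (auto simp: mult.assoc)
      moreover have "4 * q * q * w * l / (l\<^sup>2 * (l - w)) = 4 * q\<^sup>2 / (l - w) - 4 * q\<^sup>2 / l"
        using l0 by (simp add: field_simps power2_eq_square)
      moreover have "4 * q * r * s * (l - w) / (l\<^sup>2 * (l - w)) = 4 * q * r * s / l\<^sup>2" using l0 by simp
      moreover have "4 * q\<^sup>2 / l \<le> (p\<^sup>2 + (r\<^sup>2 + 2 * q\<^sup>2)) / l"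
        using qr(2) l0 by (intro divide_right_mono) auto
      moreover have "(p\<^sup>2 + (r\<^sup>2 + 2 * q\<^sup>2)) / l = p\<^sup>2 / l + (r\<^sup>2 + 2 * q\<^sup>2) * (1 / l)"
        by (simp add: add_divide_distrib)
      ultimately show ?thesis using A B by linarith
    qed
    moreover have "l = (real n - 5) * p\<^sup>2 / l + 4 * q\<^sup>2 / (l - w)" using l(2) by (simp add: g2_def)
    moreover have "(real n - 4) * p\<^sup>2 / l = (real n - 5) * p\<^sup>2 / l + p\<^sup>2 / l"
      by (simp add: left_diff_distrib diff_divide_distrib)
    ultimately show "l < g1 l" unfolding g1_def by linarith
  qed
  have k0: "0 < k" and k2: "0 < k\<^sup>2 - 2 * s\<^sup>2" using k(1) l0 sq[of k] by auto
  have disjoint: "rho f G = l" if "two_chords n c e e' G" "e \<inter> e' = {}" for c e e' G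
  proof (rule rho_disjoint_chords[where x = "q / (l - w)" and y = "p / l", OF that _ f0 fc])
    show "l * (q / (l - w)) = f (real n - 1) 2 + f 2 2 * (q / (l - w))"
      unfolding q_def[symmetric] w_def[symmetric] using l0 by (simp add: field_simps)
    show "l = (real n - 5) * (f (real n - 1) 1 * (p / l)) + 4 * (f (real n - 1) 2 * (q / (l - w)))"
      using l(2) unfolding p_def[symmetric] q_def[symmetric] g2_def by (simp add: power2_eq_square)
  qed (use n pos l0 in \<open>auto simp: p_def\<close>)
  have adjacent: "rho f G = k" if "two_chords n c {a, b} {a, d} G" for c a b d G
  proof -
    let ?D = "k\<^sup>2 - 2 * s\<^sup>2"
    \<comment> \<open>Cramer's rule for \<open>k * x = r + 2 * s * y\<close> and
      \<open>k * y = q + s * x\<close>, the equations at the chord ends; their determinant is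
      \<open>?D\<close>.\<close>
    define x y where "x = (r * k + 2 * s * q) / ?D" and "y = (q * k + s * r) / ?D"
    have xD: "?D * x = r * k + 2 * s * q" and yD: "?D * y = q * k + s * r"
      using k2 by (auto simp: x_def y_def)
    have "?D * (k * x) = k * (r * k + 2 * s * q)" using xD by (metis mult.left_commute)
    also have "\<dots> = ?D * r + 2 * s * (q * k + s * r)" by (simp add: algebra_simps power2_eq_square)
    also have "\<dots> = ?D * (r + 2 * (s * y))" unfolding yD[symmetric] by (simp add: algebra_simps)
    finally have x: "k * x = r + 2 * (s * y)" using k2 by simp
    have "?D * (k * y) = k * (q * k + s * r)" using yD by (metis mult.left_commute)
    also have "\<dots> = ?D * q + s * (r * k + 2 * s * q)" by (simp add: algebra_simps power2_eq_square)
    also have "\<dots> = ?D * (q + s * x)" unfolding xD[symmetric] by (simp add: algebra_simps)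
    finally have y: "k * y = q + s * x" using k2 by simp
    have "r * x + 2 * (q * y) = (r * (r * k + 2 * s * q) + 2 * q * (q * k + s * r)) / ?D"
      by (simp add: x_def y_def add_divide_distrib algebra_simps)
    also have "\<dots> = (r\<^sup>2 + 2 * q\<^sup>2) * (k / ?D) + 4 * q * r * s / ?D"
      unfolding times_divide_eq_right add_divide_distrib[symmetric]
      by (rule arg_cong[where f = "\<lambda>z. z / ?D"]) (simp add: algebra_simps power2_eq_square)
    finally have k': "k = (real n - 4) * (p * (p / k)) + r * x + 2 * (q * y)"
      using k(2) unfolding g1_def by (simp add: power2_eq_square)
    have "0 < x" "0 < y" using k2 k0 pos r0 by (auto simp: x_def y_def intro!: divide_pos_pos add_pos_pos)
    then show ?thesis
      using n pos k0 x y k' unfolding p_def q_def r_def s_def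
      by (intro rho_adjacent_chords[where x = x and y = y and z = "p / k", OF that _ f0 fc]) (auto simp: p_def)
  qed
  have classify: "rho f G \<le> \<mu> \<or> rho f G = k \<or>
      rho f G = l \<and> digraph_iso (with_proj G) (with_proj (G2 n))" if G: "G \<in> bicyclic_graphs n" for G
  proof (cases "\<forall>u<n. card (nbrs G u) \<le> n - 2")
    case True
    then show ?thesis using low[OF G] by auto
  next
    case False
    then obtain c where "c < n" "n - 1 \<le> card (nbrs G c)" by (auto simp: not_le)
    then obtain e e' where ee: "two_chords n c e e' G"
      using two_chords_if_dominating[OF G] n by auto
    show ?thesis
    proof (cases "e \<inter> e' = {}")
      case True
      then show ?thesis using disjoint[OF ee] disjoint_chords_iso_G2[OF ee] n by auto
    next
      case False
      then obtain a where a: "a \<in> e" "a \<in> e'" by blast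
      have "card e = 2" "card e' = 2" using ee by (auto simp: two_chords_def)
      then obtain b d where "e = {a, b}" "e' = {a, d}"
        using a by (auto simp: card_2_iff)
      then show ?thesis using adjacent ee by auto
    qed
  qed
  let ?B = "bicyclic_graphs n"
  have G2: "G2 n \<in> ?B" "rho f (G2 n) = l"
    using two_chords_bicyclic[OF G2_two_chords] disjoint[OF G2_two_chords] n by auto
  \<comment> \<open>A star with adjacent chords on the given vertex set, witnessing that
    \<open>k\<close> is attained.\<close>
  define G1 where "G1 = \<lparr>pverts = {..<n},
    parcs = {(u, v). {u, v} \<in> (\<lambda>k. {0, k}) ` ({..<n} - {0}) \<union> {{1, 2}, {1, 3}}}\<rparr>"
  have G1': "two_chords n 0 {1, 2} {1, 3} G1"
    using n by (auto simp: two_chords_def G1_def doubleton_eq_iff)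
  have G1: "G1 \<in> ?B" "rho f G1 = k"
    using two_chords_bicyclic[OF G1'] adjacent[OF G1'] n by auto
  have kB: "k \<in> rho f ` ?B" and lB: "l \<in> rho f ` ?B" using G1 G2 by (metis imageI)+
  have "\<exists>!m. m \<in> rho f ` ?B \<and> l < m"
  proof (rule ex1I[of _ k])
    show "k \<in> rho f ` ?B \<and> l < k" using kB k by simp
    show "m = k" if "m \<in> rho f ` ?B \<and> l < m" for m
      using that classify l(1) by force
  qed
  moreover have "digraph_iso (with_proj G) (with_proj (G2 n))"
    if G: "attains_second_largest (rho f) ?B G" for G
  proof (rule ccontr)
    assume not: "\<not> ?thesis"
    from G have GB: "G \<in> ?B" and ex1: "\<exists>!m. m \<in> rho f ` ?B \<and> rho f G < m"
      by (auto simp: attains_second_largest_def)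
    \<comment> \<open>A value of at most \<open>\<mu>\<close> has both \<open>l\<close> and
      \<open>k\<close> above it, and \<open>k\<close> has nothing above it; neither leaves exactly
      one larger value.\<close>
    from classify[OF GB] not consider "rho f G \<le> \<mu>" | "rho f G = k" by blast
    then show False
    proof cases
      case 1
      then have "rho f G < l" "rho f G < k" using l(1) k(1) by auto
      with ex1 kB lB have "k = l" by blast
      with k(1) show False by simp
    next
      case 2
      from ex1 obtain H where "H \<in> ?B" "k < rho f H" unfolding 2 by auto
      with classify[of H] l(1) k(1) show False by auto
    qed
  qed
  ultimately show ?thesis using G2 by (simp add: attains_second_largest_def)
qed

section \<open>The three weight functions\<close>

lemma low_degree_bound_add:
  assumes n: "10 \<le> n" and T: "T = sqrt (real n - 1)"
    and G: "G \<in> bicyclic_graphs n" and max: "\<And>u. u < n \<Longrightarrow> card (nbrs G u) \<le> n - 2"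
  shows "rho (\<lambda>x y. x + y) G \<le> (T ^ 5 + T ^ 3 + 4 * T + 7) / T\<^sup>2"
proof -
  have T2: "real n = T\<^sup>2 + 1" using n by (simp add: T)
  have T3: "3 \<le> T" unfolding T using n by (intro real_le_rsqrt) auto
  define b where "b = (T - 1) / (T\<^sup>2 - 2)"
  have b: "0 \<le> b" unfolding b_def using T3 T2 n by (intro divide_nonneg_nonneg) auto
  show ?thesis
  proof (rule rho_le_of_row_bound[OF G _ max _ b, where ?c0.0 = "\<lambda>d. d + 1"
        and ?c1.0 = "\<lambda>d. 1 + b * (d + 2)" and ?c2.0 = "\<lambda>d. b" and ?c3.0 = "\<lambda>d. 0"])
    show "(d + 1) * d + (1 + b * (d + 2)) * S + (b + 0 * (K + 1)) * P
      \<le> (T ^ 5 + T ^ 3 + 4 * T + 7) / T\<^sup>2 * (1 + b * (d - 1))"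
      if "moment_bounds (real n) d K S P" for d K S P
      using row_bound_add[OF T3 b_def, of d K S P] that T2 by simp
  qed (use n b in \<open>auto simp: algebra_simps\<close>)
qed

lemma low_degree_bound_sum_square:
  assumes n: "9 \<le> n" and T: "T = sqrt (real n - 1)"
    and G: "G \<in> bicyclic_graphs n" and max: "\<And>u. u < n \<Longrightarrow> card (nbrs G u) \<le> n - 2"
  shows "rho (\<lambda>x y. (x + y)\<^sup>2) G \<le> T * ((T\<^sup>2 + 1)\<^sup>2 + 8)"
proof -
  have T2: "real n = T\<^sup>2 + 1" using n by (simp add: T)
  have T3: "11 / 4 \<le> T" unfolding T using n by (intro real_le_rsqrt) (auto simp: power2_eq_square)
  define b where "b = (T - 1) / (T\<^sup>2 - 2)"
  have b: "0 \<le> b" unfolding b_def using T3 T2 n by (intro divide_nonneg_nonneg) auto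
  show ?thesis
  proof (rule rho_le_of_row_bound[OF G _ max _ b, where ?c0.0 = "\<lambda>d. (d + 1)\<^sup>2"
        and ?c1.0 = "\<lambda>d. 2 * (d + 1) + 1 + b * (d + 2)\<^sup>2" and ?c2.0 = "\<lambda>d. 1 + 2 * b * (d + 1)"
        and ?c3.0 = "\<lambda>d. b"])
    show "(d + 1)\<^sup>2 * d + (2 * (d + 1) + 1 + b * (d + 2)\<^sup>2) * S
        + (1 + 2 * b * (d + 1) + b * (K + 1)) * P
      \<le> T * ((T\<^sup>2 + 1)\<^sup>2 + 8) * (1 + b * (d - 1))"
      if "moment_bounds (real n) d K S P" for d K S P
      using row_bound_sum_square[OF T3 b_def, of d K S P] that T2 by simp
    show "(d + (1 + y))\<^sup>2 * (1 + b * y) = (d + 1)\<^sup>2 + (2 * (d + 1) + 1 + b * (d + 2)\<^sup>2) * y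
      + (1 + 2 * b * (d + 1)) * (y * (y - 1)) + b * ((y + 1) * (y * (y - 1)))" for d y :: real
      by (simp add: algebra_simps power2_eq_square)
  qed (use n b in auto)
qed

lemma low_degree_bound_squares_sum:
  assumes n: "8 \<le> n" and T: "T = sqrt (real n - 1)"
    and G: "G \<in> bicyclic_graphs n" and max: "\<And>u. u < n \<Longrightarrow> card (nbrs G u) \<le> n - 2"
  shows "rho (\<lambda>x y. x\<^sup>2 + y\<^sup>2) G \<le> T * (T ^ 4 + 1)"
proof -
  have T2: "real n = T\<^sup>2 + 1" using n by (simp add: T)
  have T3: "5 / 2 \<le> T" unfolding T using n by (intro real_le_rsqrt) (auto simp: power2_eq_square)
  define b where "b = (T - 1) / (T\<^sup>2 - 2)"
  have b: "0 \<le> b" unfolding b_def using T3 T2 n by (intro divide_nonneg_nonneg) auto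
  show ?thesis
  proof (rule rho_le_of_row_bound[OF G _ max _ b, where ?c0.0 = "\<lambda>d. d\<^sup>2 + 1"
        and ?c1.0 = "\<lambda>d. 3 + b * (d\<^sup>2 + 4)" and ?c2.0 = "\<lambda>d. 1 + 2 * b" and ?c3.0 = "\<lambda>d. b"])
    show "(d\<^sup>2 + 1) * d + (3 + b * (d\<^sup>2 + 4)) * S + (1 + 2 * b + b * (K + 1)) * P
      \<le> T * (T ^ 4 + 1) * (1 + b * (d - 1))"
      if "moment_bounds (real n) d K S P" for d K S P
      using row_bound_squares_sum[OF T3 b_def, of d K S P] that T2 by simp
    show "(d\<^sup>2 + (1 + y)\<^sup>2) * (1 + b * y) = d\<^sup>2 + 1 + (3 + b * (d\<^sup>2 + 4)) * y
      + (1 + 2 * b) * (y * (y - 1)) + b * ((y + 1) * (y * (y - 1)))" for d y :: real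
      by (simp add: algebra_simps power2_eq_square)
  qed (use n b in auto)
qed

lemma second_largest_add:
  assumes n: "10 \<le> n" and f: "f = (\<lambda>x y. x + y)"
  shows "attains_second_largest (rho f) (bicyclic_graphs n) (G2 n) \<and>
         (\<forall>G. attains_second_largest (rho f) (bicyclic_graphs n) G \<longrightarrow>
              digraph_iso (with_proj G) (with_proj (G2 n)))"
proof -
  define T where "T = sqrt (real n - 1)"
  \<comment> \<open>The fixed point for disjoint chords expands as T^3 + T + 4/T + 8/T^2 + O(1/T^3),
    where T^3 + T is the radius of the star; \<open>\<mu>\<close> takes 7 in place of 8. In
    \<open>row_bound_add\<close> the degree 2 row at T = 3 has slack 9, and each unit taken from 7
    costs 9, so the row bound does not allow less than 6.\<close>
  define \<mu> where "\<mu> = (T ^ 5 + T ^ 3 + 4 * T + 7) / T\<^sup>2"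
  have T2: "real n = T\<^sup>2 + 1" using n by (simp add: T_def)
  have T3: "3 \<le> T" unfolding T_def using n by (intro real_le_rsqrt) auto
  have \<mu>T: "\<mu> * T\<^sup>2 = T ^ 5 + T ^ 3 + 4 * T + 7" using T3 by (simp add: \<mu>_def)
  have \<mu>27: "27 \<le> \<mu>"
  proof -
    have "3 ^ 3 \<le> T ^ 3" using T3 by (intro power_mono) auto
    then have "27 * T\<^sup>2 \<le> T ^ 3 * T\<^sup>2" by (intro mult_right_mono) auto
    also have "\<dots> \<le> \<mu> * T\<^sup>2" unfolding \<mu>T using T3 by (simp flip: power_add)
    finally show ?thesis using T3 by simp
  qed
  have sec: "\<mu> ^ 3 < (real n - 5) * (real n)\<^sup>2 * \<mu> + 4 * (real n + 1)\<^sup>2 * (\<mu> + 4)"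
  proof -
    define t where "t = T - 3"
    have t: "0 \<le> t" using T3 by (simp add: t_def)
    let ?a = "(T\<^sup>2 - 4) * (T\<^sup>2 + 1)\<^sup>2" and ?c = "4 * (T\<^sup>2 + 2)\<^sup>2"
    have "T ^ 6 * (?a * \<mu> + ?c * (\<mu> + 4) - \<mu> ^ 3)
      = ?a * (\<mu> * T\<^sup>2) * T ^ 4 + ?c * ((\<mu> * T\<^sup>2) * T ^ 4 + 4 * T ^ 6) - (\<mu> * T\<^sup>2) ^ 3"
      by (simp add: algebra_simps power_numeral_reduce)
    also have "\<dots> = 308231 + 1031172 * t + 1457223 * t ^ 2 + 1177763 * t ^ 3 + 610773 * t ^ 4
      + 214197 * t ^ 5 + 51850 * t ^ 6 + 8628 * t ^ 7 + 954 * t ^ 8 + 64 * t ^ 9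
      + 2 * t ^ 10"
      unfolding \<mu>T by (simp add: t_def algebra_simps power_numeral_reduce)
    also have "\<dots> > 0" using t by (intro add_pos_nonneg) auto
    finally have "0 < ?a * \<mu> + ?c * (\<mu> + 4) - \<mu> ^ 3" using T3 by (simp add: zero_less_mult_iff)
    then show ?thesis unfolding T2 by (simp add: add.commute)
  qed
  have low: "rho f G \<le> \<mu>" if "G \<in> bicyclic_graphs n" "\<And>u. u < n \<Longrightarrow> card (nbrs G u) \<le> n - 2" for G
    using low_degree_bound_add[OF n T_def that] unfolding f \<mu>_def .
  \<comment> \<open>This is \<open>2 * s\<^sup>2 < \<mu>\<^sup>2\<close> with
    \<open>s = f 2 3 = 5\<close>; the constants 1250 and 338 for the other weights come in the same
    way from 25 and 13.\<close>
  have sq: "50 < \<mu>\<^sup>2"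
    using power_mono[OF \<mu>27, of 2] by simp
  show ?thesis
  proof (rule second_largest_if_low_degree_bound[OF _ _ _ _ _ _ _ _ _ _ _ _ _ low])
    show "\<mu> < (real n - 5) * (f (real n - 1) 1)\<^sup>2 / \<mu> + 4 * (f (real n - 1) 2)\<^sup>2 / (\<mu> - f 2 2)"
      using secular_gt[of 4 \<mu> "(real n - 5) * (real n)\<^sup>2" "4 * (real n + 1)\<^sup>2"] sec \<mu>27
      by (simp add: f add.commute)
    show "2 * (f (real n - 1) 2)\<^sup>2 \<le> (f (real n - 1) 1)\<^sup>2 + (f (real n - 1) 3)\<^sup>2"
      by (simp add: f power2_eq_square algebra_simps)
  qed (use n \<mu>27 sq in \<open>auto simp: f\<close>)
qed

lemma second_largest_sum_square:
  assumes n: "9 \<le> n" and f: "f = (\<lambda>x y. (x + y)\<^sup>2)"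
  shows "attains_second_largest (rho f) (bicyclic_graphs n) (G2 n) \<and>
         (\<forall>G. attains_second_largest (rho f) (bicyclic_graphs n) G \<longrightarrow>
              digraph_iso (with_proj G) (with_proj (G2 n)))"
proof -
  define T where "T = sqrt (real n - 1)"
  define N where "N = real n"
  \<comment> \<open>The radius of the star is \<open>T * N\<^sup>2\<close>. With the added 8,
    \<open>\<mu>\<^sup>2\<close> agrees with \<open>(N - 5) * (N\<^sup>2)\<^sup>2 + 4 * ((N +
    1)\<^sup>2)\<^sup>2\<close> in the powers N^5, N^4 and N^3; a larger constant would exceed it
    for large N.\<close>
  define \<mu> where "\<mu> = T * (N\<^sup>2 + 8)"
  have N: "9 \<le> N" and T2: "N = T\<^sup>2 + 1" using n by (auto simp: T_def N_def)
  have T3: "2 \<le> T" unfolding T_def using n by (intro real_le_rsqrt) auto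
  have \<mu>: "100 \<le> \<mu>"
  proof -
    have "9\<^sup>2 \<le> N\<^sup>2" using N by (intro power_mono) auto
    then have "2 * 50 \<le> T * (N\<^sup>2 + 8)" using T3 by (intro mult_mono) auto
    then show ?thesis by (simp add: \<mu>_def)
  qed
  have sec: "\<mu> ^ 3 < (N - 5) * (N\<^sup>2)\<^sup>2 * \<mu> + 4 * ((N + 1)\<^sup>2)\<^sup>2 * (\<mu> + 16)"
  proof -
    have "\<mu>\<^sup>2 = T\<^sup>2 * (N\<^sup>2 + 8)\<^sup>2" by (simp add: \<mu>_def power_mult_distrib)
    also have "T\<^sup>2 = N - 1" using T2 by simp
    also have "(N - 1) * (N\<^sup>2 + 8)\<^sup>2
        = (N - 5) * (N\<^sup>2)\<^sup>2 + 4 * ((N + 1)\<^sup>2)\<^sup>2 - (40 * N * (N - 9) + 312 * N + 68)"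
      by (simp add: algebra_simps power2_eq_square)
    also have "\<dots> \<le> (N - 5) * (N\<^sup>2)\<^sup>2 + 4 * ((N + 1)\<^sup>2)\<^sup>2"
    proof -
      have "0 \<le> 40 * N * (N - 9)" using N by (intro mult_nonneg_nonneg) auto
      then show ?thesis using N by linarith
    qed
    finally have "\<mu>\<^sup>2 * \<mu> \<le> ((N - 5) * (N\<^sup>2)\<^sup>2 + 4 * ((N + 1)\<^sup>2)\<^sup>2) * \<mu>"
      using \<mu> by (intro mult_right_mono) auto
    moreover have "0 < 4 * ((N + 1)\<^sup>2)\<^sup>2 * 16" using N by simp
    moreover have "\<mu>\<^sup>2 * \<mu> = \<mu> ^ 3" by (simp add: power_numeral_reduce)
    ultimately show ?thesis unfolding distrib_left distrib_right by linarith
  qed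
  have low: "rho f G \<le> \<mu>" if "G \<in> bicyclic_graphs n" "\<And>u. u < n \<Longrightarrow> card (nbrs G u) \<le> n - 2" for G
    using low_degree_bound_sum_square[OF n T_def that] unfolding f \<mu>_def T2 .
  have sq: "1250 < \<mu>\<^sup>2" using power_mono[OF \<mu>, of 2] by simp
  show ?thesis
  proof (rule second_largest_if_low_degree_bound[OF _ _ _ _ _ _ _ _ _ _ _ _ _ low])
    show "\<mu> < (real n - 5) * (f (real n - 1) 1)\<^sup>2 / \<mu> + 4 * (f (real n - 1) 2)\<^sup>2 / (\<mu> - f 2 2)"
      using secular_gt[of 16 \<mu> "(N - 5) * (N\<^sup>2)\<^sup>2" "4 * ((N + 1)\<^sup>2)\<^sup>2"] sec \<mu>
      by (simp add: f N_def add.commute)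
    show "2 * (f (real n - 1) 2)\<^sup>2 \<le> (f (real n - 1) 1)\<^sup>2 + (f (real n - 1) 3)\<^sup>2"
      by (simp add: f power2_eq_square algebra_simps)
    show "f (real n - 1) 2 \<le> f (real n - 1) 3" using n by (simp add: f power_mono)
  qed (use n \<mu> sq in \<open>auto simp: f add.commute\<close>)
qed

lemma second_largest_squares_sum:
  assumes n: "8 \<le> n" and f: "f = (\<lambda>x y. x\<^sup>2 + y\<^sup>2)"
  shows "attains_second_largest (rho f) (bicyclic_graphs n) (G2 n) \<and>
         (\<forall>G. attains_second_largest (rho f) (bicyclic_graphs n) G \<longrightarrow>
              digraph_iso (with_proj G) (with_proj (G2 n)))"
proof -
  define T where "T = sqrt (real n - 1)"
  define m where "m = (real n - 1)\<^sup>2"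
  \<comment> \<open>Exactly the radius of the star, as \<open>f (n - 1) 1 = m + 1\<close>. Turning
    four leaves into chord ends raises their edge weight to \<open>m + 4\<close>, which already
    suffices for \<open>sec\<close>.\<close>
  define \<mu> where "\<mu> = T * (m + 1)"
  have T2: "real n = T\<^sup>2 + 1" using n by (auto simp: T_def)
  have T4: "m = T ^ 4" by (simp add: m_def T2 flip: power_mult)
  have T3: "2 \<le> T" unfolding T_def using n by (intro real_le_rsqrt) auto
  have m: "7\<^sup>2 \<le> m" unfolding m_def using n by (intro power_mono) auto
  have \<mu>: "100 \<le> \<mu>"
  proof -
    have "2 * 50 \<le> T * (m + 1)" using T3 m by (intro mult_mono) auto
    then show ?thesis by (simp add: \<mu>_def)
  qed
  have sec: "\<mu> ^ 3 < (real n - 5) * (m + 1)\<^sup>2 * \<mu> + 4 * (m + 4)\<^sup>2 * (\<mu> + 8)"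
  proof -
    have "\<mu>\<^sup>2 = T\<^sup>2 * (m + 1)\<^sup>2" by (simp add: \<mu>_def power_mult_distrib)
    also have "T\<^sup>2 = real n - 1" using T2 by simp
    also have "(real n - 1) * (m + 1)\<^sup>2 = (real n - 5) * (m + 1)\<^sup>2 + 4 * (m + 1)\<^sup>2"
      by (simp add: algebra_simps)
    also have "\<dots> \<le> (real n - 5) * (m + 1)\<^sup>2 + 4 * (m + 4)\<^sup>2"
      using m by (intro add_left_mono mult_left_mono power_mono) auto
    finally have "\<mu>\<^sup>2 * \<mu> \<le> ((real n - 5) * (m + 1)\<^sup>2 + 4 * (m + 4)\<^sup>2) * \<mu>"
      using \<mu> by (intro mult_right_mono) auto
    moreover have "0 < 4 * (m + 4)\<^sup>2 * 8" using m by simp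
    moreover have "\<mu>\<^sup>2 * \<mu> = \<mu> ^ 3" by (simp add: power_numeral_reduce)
    ultimately show ?thesis unfolding distrib_left distrib_right by linarith
  qed
  have low: "rho f G \<le> \<mu>" if "G \<in> bicyclic_graphs n" "\<And>u. u < n \<Longrightarrow> card (nbrs G u) \<le> n - 2" for G
    using low_degree_bound_squares_sum[OF n T_def that] unfolding f \<mu>_def T4 .
  have sq: "338 < \<mu>\<^sup>2" using power_mono[OF \<mu>, of 2] by simp
  show ?thesis
  proof (rule second_largest_if_low_degree_bound[OF _ _ _ _ _ _ _ _ _ _ _ _ _ low])
    show "\<mu> < (real n - 5) * (f (real n - 1) 1)\<^sup>2 / \<mu> + 4 * (f (real n - 1) 2)\<^sup>2 / (\<mu> - f 2 2)"
      using secular_gt[of 8 \<mu> "(real n - 5) * (m + 1)\<^sup>2" "4 * (m + 4)\<^sup>2"] sec \<mu>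
      by (simp add: f m_def)
    show "2 * (f (real n - 1) 2)\<^sup>2 \<le> (f (real n - 1) 1)\<^sup>2 + (f (real n - 1) 3)\<^sup>2"
      unfolding f m_def[symmetric] using m by (simp add: power2_eq_square algebra_simps)
  qed (use n \<mu> sq m in \<open>auto simp: f add.commute simp flip: m_def\<close>)
qed

theorem theorem3p2:
  fixes n :: nat and f :: "real \<Rightarrow> real \<Rightarrow> real"
  assumes "(f = (\<lambda>x y. x + y) \<and> n \<ge> 10) \<or>
           (f = (\<lambda>x y. (x + y)\<^sup>2) \<and> n \<ge> 9) \<or>
           (f = (\<lambda>x y. x\<^sup>2 + y\<^sup>2) \<and> n \<ge> 8)"
  shows "attains_second_largest (rho f) (bicyclic_graphs n) (G2 n) \<and>
         (\<forall>G. attains_second_largest (rho f) (bicyclic_graphs n) G \<longrightarrow>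
              digraph_iso (with_proj G) (with_proj (G2 n)))"
  using assms second_largest_add second_largest_sum_square second_largest_squares_sum by blast

end
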